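(* Let $G$ be a finite group of odd order. Then for any integer $a$, $$\left(\frac{a}{G}\right)=\left(\frac{a}{|G|}\right),$$ where the left side is the quadratic symbol of $G$ and the right side is the Jacobi symbol.
   Context: Let $G$ be a finite group of order $n=|G|$ with conjugacy classes $C_1=\{1\}, C_2,\dots,C_m$. Quadratic symbol of $G$: an integer $a$ prime to $n$ acts as a permutation on the set of the $m$ conjugacy classes of $G$ by sending the class of $g$ to the class of $g^a$. For any integer $a$, define $\left(\frac{a}{G}\right)=0$ if $\gcd(a,n)\neq 1$; $\left(\frac{a}{G}\right)=1$ if $\gcd(a,n)=1$ and this permutation is even; $\left(\frac{a}{G}\right)=-1$ if $\gcd(a,n)=1$ and this permutation is odd. Jacobi symbol: for an odd positive integer $n=p_1\cdots p_r$ with $p_k$ (not necessarily distinct) primes, $\left(\frac{a}{n}\right)=\prod_{k=1}^r\left(\frac{a}{p_k}\right)$, where $\left(\frac{a}{p}\right)$ is the Legendre symbol ($0$ if $p\mid a$, $1$ if $p \nmid a$ and $a$ is a square modulo $p$, $-1$ otherwise); for $n=1$ the empty product gives $1$. *)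

theory Defs
  imports
    "HOL-Algebra.Group_Action"
    "HOL-Algebra.Elementary_Groups"
    "HOL-Algebra.Multiplicative_Group"
    "HOL-Combinatorics.Permutations"
    "HOL-Number_Theory.Number_Theory"
begin

definition conj_class :: "('a, 'b) monoid_scheme \<Rightarrow> 'a \<Rightarrow> 'a set"
  where "conj_class G g =
    orbit G (\<lambda>h. \<lambda>x\<in>carrier G. h \<otimes>\<^bsub>G\<^esub> x \<otimes>\<^bsub>G\<^esub> inv\<^bsub>G\<^esub> h) g"

definition conj_classes :: "('a, 'b) monoid_scheme \<Rightarrow> 'a set set"
  where "conj_classes G = conj_class G ` carrier G"

text \<open>The class of \<open>g\<close> goes to the class of \<open>g [^] a\<close>; independence of the representative
  is \<open>class_power_conj_class\<close> below.\<close>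
definition class_power :: "('a, 'b) monoid_scheme \<Rightarrow> int \<Rightarrow> 'a set \<Rightarrow> 'a set"
  where "class_power G a C = (THE D. \<forall>g\<in>C. D = conj_class G (g [^]\<^bsub>G\<^esub> a))"

text \<open>\<^const>\<open>evenperm\<close> refers to permutations of the whole type \<open>'a set\<close>, so the action on the
  conjugacy classes is extended by the identity; see \<open>class_power_permutes\<close>.\<close>
definition quadratic_symbol :: "int \<Rightarrow> ('a, 'b) monoid_scheme \<Rightarrow> int"
  where "quadratic_symbol a G =
    (if \<not> coprime a (int (order G)) then 0
     else if evenperm (restrict_id (class_power G a) (conj_classes G)) then 1
     else - 1)"

text \<open>Only meaningful for odd \<open>n\<close>.\<close>
definition jacobi_symbol :: "int \<Rightarrow> nat \<Rightarrow> int"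
  where "jacobi_symbol a n = (\<Prod>p\<in>#prime_factorization n. Legendre a (int p))"

context group
begin

lemma conj_class_eq:
  assumes "g \<in> carrier G"
  shows "conj_class G g = {h \<otimes> g \<otimes> inv h | h. h \<in> carrier G}"
  using assms unfolding conj_class_def orbit_def by auto

lemma conj_class_self: "g \<in> carrier G \<Longrightarrow> g \<in> conj_class G g"
  by (auto simp: conj_class_eq intro!: exI[of _ \<one>])

lemma inv_mult_cancel: "x \<in> carrier G \<Longrightarrow> y \<in> carrier G \<Longrightarrow> inv x \<otimes> (x \<otimes> y) = y"
  by (simp flip: m_assoc)

lemma conj_class_conj:
  assumes "g \<in> carrier G" "x \<in> carrier G"
  shows "conj_class G (x \<otimes> g \<otimes> inv x) = conj_class G g"
proof -
  let ?y = "x \<otimes> g \<otimes> inv x"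
  have y: "?y \<in> carrier G" using assms by simp
  show ?thesis
  proof (intro equalityI subsetI)
    fix z assume "z \<in> conj_class G ?y"
    then obtain h where h: "h \<in> carrier G" "z = h \<otimes> ?y \<otimes> inv h"
      unfolding conj_class_eq[OF y] by blast
    then have "z = (h \<otimes> x) \<otimes> g \<otimes> inv (h \<otimes> x)"
      using assms by (simp add: inv_mult_group m_assoc)
    moreover have "h \<otimes> x \<in> carrier G"
      using h(1) assms by simp
    ultimately show "z \<in> conj_class G g"
      unfolding conj_class_eq[OF assms(1)] by blast
  next
    fix z assume "z \<in> conj_class G g"
    then obtain h where h: "h \<in> carrier G" "z = h \<otimes> g \<otimes> inv h"
      unfolding conj_class_eq[OF assms(1)] by blast
    then have "z = (h \<otimes> inv x) \<otimes> ?y \<otimes> inv (h \<otimes> inv x)"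
      using assms by (simp add: inv_mult_group m_assoc inv_mult_cancel)
    moreover have "h \<otimes> inv x \<in> carrier G"
      using h(1) assms by simp
    ultimately show "z \<in> conj_class G ?y"
      unfolding conj_class_eq[OF y] by blast
  qed
qed

lemma conj_int_pow:
  assumes "g \<in> carrier G" "x \<in> carrier G"
  shows "(x \<otimes> g \<otimes> inv x) [^] (a :: int) = x \<otimes> (g [^] a) \<otimes> inv x"
proof -
  have "(\<lambda>y. x \<otimes> y \<otimes> inv x) \<in> hom G G"
    using assms by (auto intro!: homI simp: m_assoc inv_mult_cancel)
  then interpret f: group_hom G G "\<lambda>y. x \<otimes> y \<otimes> inv x"
    by unfold_locales
  show ?thesis using f.hom_int_pow[OF assms(1), of a] by simp
qed

lemma class_power_conj_class:
  assumes "g \<in> carrier G"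
  shows "class_power G a (conj_class G g) = conj_class G (g [^] a)"
proof -
  have *: "conj_class G (y [^] a) = conj_class G (g [^] a)" if y: "y \<in> conj_class G g" for y
  proof -
    obtain x where "x \<in> carrier G" "y = x \<otimes> g \<otimes> inv x"
      using y assms by (auto simp: conj_class_eq)
    then show ?thesis using assms by (simp add: conj_int_pow conj_class_conj)
  qed
  show ?thesis unfolding class_power_def
  proof (rule the_equality)
    show "\<forall>y\<in>conj_class G g. conj_class G (g [^] a) = conj_class G (y [^] a)"
      using *[symmetric] by blast
    show "D = conj_class G (g [^] a)" if "\<forall>y\<in>conj_class G g. D = conj_class G (y [^] a)" for D
      using that conj_class_self[OF assms] by blast
  qed
qed

lemma class_power_permutes:
  assumes "finite (carrier G)" "coprime a (int (order G))"
  shows "restrict_id (class_power G a) (conj_classes G) permutes conj_classes G"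
proof -
  obtain b c where bc: "a * b + int (order G) * c = 1"
    using bezout_int[of a "int (order G)"] assms(2) by (auto simp: mult.commute)
  have pow: "(g [^] a) [^] b = g" "(g [^] b) [^] a = g" if g: "g \<in> carrier G" for g
  proof -
    have "g [^] int (order G) = \<one>"
      using pow_order_eq_1[OF g] by (simp add: int_pow_int)
    then have "g [^] (int (order G) * c) = \<one>"
      using int_pow_pow[OF g, of "int (order G)" c] by (simp add: int_pow_one)
    then have "g [^] (a * b) = g"
      using int_pow_mult[OF g, of "a * b" "int (order G) * c"] g bc by simp
    then show "(g [^] a) [^] b = g" "(g [^] b) [^] a = g"
      using int_pow_pow[OF g, of a b] int_pow_pow[OF g, of b a]
      by (simp_all add: mult.commute[of b a])
  qed
  have "bij_betw (class_power G a) (conj_classes G) (conj_classes G)"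
    by (rule bij_betw_byWitness[where f' = "class_power G b"])
      (auto simp: conj_classes_def class_power_conj_class pow)
  then have "bij_betw (restrict_id (class_power G a) (conj_classes G)) (conj_classes G) (conj_classes G)"
    by (intro bij_betw_restrict_id) auto
  then show ?thesis
    by (rule bij_imp_permutes) simp
qed

end

end

theory Submission
  imports "Jordan_Normal_Form.Determinant" Defs
begin

text \<open>Write \<open>n\<close> for the order of \<open>G\<close>. Both symbols are multiplicative in \<open>a\<close>, depend only on \<open>a\<close> modulo \<open>n\<close>
  and vanish if \<open>a\<close> is not prime to \<open>n\<close>. As \<open>n\<close> is odd, every residue class prime to \<open>n\<close> contains an odd
  positive number, so it is enough to treat an odd prime \<open>a = q\<close> that does not divide \<open>n\<close>.

  Since \<open>n\<close> is odd, inversion fixes no conjugacy class but the trivial one. Let \<open>k\<close> be the number of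
  pairs \<open>{C, C\<^sup>-\<^sup>1}\<close> of nontrivial classes and choose a class in each pair. The \<open>q\<close>-th power map permutes the
  pairs, and it takes each chosen class to a chosen class or to the inverse of one. The sign of the
  permutation of all classes is the product of the \<open>k\<close> signs that arise, as in Gauss's lemma
  (\<open>sign_class_power\<close>).

  This product is computed modulo \<open>q\<close> in the commutative ring \<open>Z\<close> of class functions under convolution,
  in the manner of Stickelberger's theorem on discriminants but without characters. In
  characteristic \<open>q\<close> the Frobenius endomorphism \<open>z \<mapsto> z\<^sup>q\<close> of \<open>Z\<close> is transport along the \<open>q\<close>-th power map
  (\<open>cpow_prime\<close>). Call a class function even or odd according to its behaviour under inversion, let
  \<open>N\<close> be the constant function 1, let \<open>\<theta>\<close> be odd, and put \<open>\<delta> = \<theta>\<^sup>2 + n N\<close>. Since \<open>\<theta> N = 0\<close>, one has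
  \<open>\<theta> \<delta>\<^sup>r = \<theta>\<^sup>q\<close> for \<open>r = (q - 1) / 2\<close>. Let \<open>D\<close> be the matrix of multiplication by \<open>\<delta>\<close> on the even functions,
  and let \<open>T\<close> be the square matrix of the map that takes an even function \<open>z\<close> to the odd function
  \<open>\<theta> z\<close> together with the sum of the values of \<open>z\<close>.

  Comparing the bilinear forms \<open>(x, y) \<mapsto> (x y)(1)\<close> on source and target of \<open>T\<close> gives
  \<open>det D = (det T)\<^sup>2 (-1)\<^sup>k n\<close> (\<open>det_quad\<close>). Applying Frobenius to \<open>\<theta> z\<close> shows that conjugating \<open>T D\<^sup>r\<close> by the
  permutation of the pairs and multiplying its rows by the signs turns it into \<open>T\<close> modulo \<open>q\<close>
  (\<open>frobenius_identity\<close>). If \<open>det T\<close> is prime to \<open>q\<close>, which is possible by \<open>ex_odd_matrix_coprime\<close>, the product of the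
  signs is therefore congruent to \<open>((-1)\<^sup>k n)\<^sup>r\<close>, that is, to the Legendre symbol of \<open>(-1)\<^sup>k n\<close> modulo \<open>q\<close>.
  Counting elements gives \<open>n = 1 + 2 \<Sum> |C|\<close> over the \<open>k\<close> chosen classes, all of odd size, so \<open>k\<close> and
  \<open>(n - 1) / 2\<close> have the same parity, and quadratic reciprocity turns the Legendre symbol into the
  Jacobi symbol of \<open>q\<close> modulo \<open>n\<close>.\<close>

section \<open>Legendre and Jacobi symbols\<close>

lemma Legendre_cong: "[a = b] (mod p) \<Longrightarrow> Legendre a p = Legendre b p"
  by (simp add: Legendre_def QuadRes_def cong_def)

lemma Legendre_values: "Legendre a p \<in> {- 1, 0, 1}"
  by (auto simp: Legendre_def)

text \<open>Turns Euler-type congruences into equalities of symbols.\<close>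
lemma cong_imp_eq_signs:
  fixes x y p :: int
  assumes "[x = y] (mod p)" "2 < p" "x \<in> {- 1, 0, 1}" "y \<in> {- 1, 0, 1}"
  shows "x = y"
proof -
  have "p dvd x - y" using assms(1) by (simp add: cong_iff_dvd_diff)
  moreover have "\<bar>x - y\<bar> < p" using assms(2-4) by auto
  ultimately have "x - y = 0" using dvd_imp_le_int[of "x - y" p] by fastforce
  then show ?thesis by simp
qed

lemma Legendre_mult:
  assumes "prime (p :: nat)" "2 < p"
  shows "Legendre (a * b) p = Legendre a p * Legendre b p"
proof (rule cong_imp_eq_signs)
  have "[Legendre (a * b) p = (a * b) ^ ((p - 1) div 2)] (mod p)"
    using assms by (rule euler_criterion)
  moreover have "[Legendre a p * Legendre b p = a ^ ((p - 1) div 2) * b ^ ((p - 1) div 2)] (mod p)"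
    using assms by (intro cong_mult euler_criterion)
  ultimately show "[Legendre (a * b) p = Legendre a p * Legendre b p] (mod p)"
    by (simp add: power_mult_distrib cong_def)
  show "Legendre a p * Legendre b p \<in> {- 1, 0, 1}"
    using Legendre_values[of a p] Legendre_values[of b p] by auto
qed (use assms Legendre_values in auto)

lemma Legendre_1:
  assumes "prime (p :: nat)"
  shows "Legendre 1 p = 1"
proof -
  have "\<not> int p dvd 1" using assms by auto
  moreover have "QuadRes (int p) 1" unfolding QuadRes_def by (rule exI[of _ 1]) simp
  ultimately show ?thesis by (simp add: Legendre_def cong_0_iff)
qed

lemma odd_prime_factor:
  assumes "odd (n :: nat)" "p \<in># prime_factorization n"
  shows "prime p" "2 < p" "p dvd n"
proof -
  show p: "prime p" "p dvd n" using assms(2) by auto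
  then have "p \<noteq> 2" using assms(1) by auto
  then show "2 < p" using prime_ge_2_nat[OF p(1)] by simp
qed

lemma jacobi_symbol_mult:
  assumes "odd n"
  shows "jacobi_symbol (a * b) n = jacobi_symbol a n * jacobi_symbol b n"
proof -
  have "jacobi_symbol (a * b) n = (\<Prod>p\<in>#prime_factorization n. Legendre a (int p) * Legendre b (int p))"
    unfolding jacobi_symbol_def
  proof (rule arg_cong[of _ _ prod_mset], rule image_mset_cong)
    fix p assume "p \<in># prime_factorization n"
    then show "Legendre (a * b) (int p) = Legendre a (int p) * Legendre b (int p)"
      using odd_prime_factor[OF assms] by (intro Legendre_mult)
  qed
  then show ?thesis by (simp add: jacobi_symbol_def prod_mset.distrib)
qed

lemma jacobi_symbol_cong:
  assumes "[a = b] (mod int n)"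
  shows "jacobi_symbol a n = jacobi_symbol b n"
  unfolding jacobi_symbol_def
proof (rule arg_cong[of _ _ prod_mset], rule image_mset_cong)
  fix p assume "p \<in># prime_factorization n"
  then have "int p dvd int n" by auto
  then show "Legendre a p = Legendre b p"
    by (intro Legendre_cong cong_dvd_modulus[OF assms])
qed

lemma jacobi_symbol_eq_0:
  assumes "n > 0" "\<not> coprime a (int n)"
  shows "jacobi_symbol a n = 0"
proof -
  have "gcd a (int n) \<noteq> 1" using assms(2) by (simp add: coprime_iff_gcd_eq_1)
  then have "nat (gcd a (int n)) \<noteq> 1" using assms(1) by (simp add: nat_eq_iff)
  then obtain p where p: "prime p" "p dvd nat (gcd a (int n))" using prime_factor_nat by blast
  then have "int p dvd int (nat (gcd a (int n)))" by (simp only: int_dvd_int_iff)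
  then have "int p dvd gcd a (int n)" by simp
  then have d: "int p dvd a" "p dvd n" by (auto simp: int_dvd_int_iff)
  then have "Legendre a p = 0" by (simp add: Legendre_def cong_0_iff)
  moreover have "p \<in># prime_factorization n" using d p assms(1) by (simp add: in_prime_factors_iff)
  ultimately show ?thesis unfolding jacobi_symbol_def by (auto intro!: image_eqI)
qed

text \<open>Quadratic reciprocity between an odd prime and an odd number, obtained from that between
  primes: both sides are multiplicative in \<open>n\<close>, as \<open>(n - 1) div 2\<close> modulo 2 turns
  products of odd numbers into sums.\<close>
lemma Legendre_signed_reciprocity:
  assumes "prime (q :: nat)" "2 < q" "odd (n :: nat)" "\<not> q dvd n"
  shows "Legendre ((- 1) ^ ((n - 1) div 2) * int n) q = jacobi_symbol q n"
  using assms(3,4)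
proof (induction n rule: prime_divisors_induct)
  case zero
  then show ?case by simp
next
  case (unit n)
  then have "n = 1" by simp
  then show ?case using Legendre_1[OF assms(1)] by (simp add: jacobi_symbol_def)
next
  case (factor p n)
  have odd: "odd p" "odd n" and nd: "\<not> q dvd n" and pq: "p \<noteq> q" using factor.prems by auto
  have p2: "2 < p" using odd prime_ge_2_nat[OF factor.hyps(1)] by (cases "p = 2") auto
  obtain u where u: "p = 2 * u + 1" using odd(1) by (rule oddE)
  obtain v where v: "n = 2 * v + 1" using odd(2) by (rule oddE)
  note uv = u v
  have "p * n = 2 * (u + v + 2 * u * v) + 1" unfolding uv by (simp add: algebra_simps)
  then have e: "(p * n - 1) div 2 = u + v + 2 * u * v" by simp
  have up: "(p - 1) div 2 = u" "(n - 1) div 2 = v" unfolding uv by simp_all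
  have pow: "(- 1) ^ ((p * n - 1) div 2) * int (p * n) = ((- 1) ^ u * int p) * ((- 1) ^ v * int n)"
    unfolding e by (simp add: power_add power_mult)
  have eu: "[Legendre (- 1) q = (- 1) ^ ((q - 1) div 2)] (mod q)"
    using assms by (intro euler_criterion)
  have "Legendre (- 1) q = (- 1) ^ ((q - 1) div 2)"
    by (rule cong_imp_eq_signs[OF eu _ Legendre_values]) (use assms in \<open>simp_all add: minus_one_power_iff\<close>)
  moreover have "Legendre ((- 1) ^ u) q = Legendre (- 1) q ^ u"
  proof (induction u)
    case 0
    show ?case using Legendre_1[OF assms(1)] by simp
  next
    case (Suc u)
    then show ?case by (simp only: power_Suc Legendre_mult[OF assms(1,2)])
  qed
  ultimately have L1: "Legendre ((- 1) ^ u) q = (- 1) ^ (u * ((q - 1) div 2))"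
    by (subst mult.commute) (simp only: power_mult)
  have QR: "Legendre p q * Legendre q p = (- 1) ^ (u * ((q - 1) div 2))"
    using Quadratic_Reciprocity[of p q] factor.hyps(1) p2 assms(1,2) pq up by simp
  have sq: "Legendre p q * Legendre p q = 1"
  proof -
    have "Legendre p q \<noteq> 0"
      using primes_dvd_imp_eq[OF assms(1) factor.hyps(1)] pq by (auto simp: Legendre_def cong_0_iff)
    then show ?thesis using Legendre_values[of p q] by auto
  qed
  have "Legendre ((- 1) ^ u * int p) q = Legendre q p * (Legendre p q * Legendre p q)"
    unfolding Legendre_mult[OF assms(1,2)] L1 QR[symmetric] by (simp only: ac_simps)
  then have "Legendre ((- 1) ^ u * int p) q = Legendre q p" by (simp add: sq)
  moreover have "Legendre ((- 1) ^ v * int n) q = jacobi_symbol q n"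
    using factor.IH odd nd up by simp
  moreover have "jacobi_symbol q (p * n) = Legendre q p * jacobi_symbol q n"
    unfolding jacobi_symbol_def using factor.hyps(1) odd_pos[OF odd(2)]
    by (subst prime_factorization_times_prime) auto
  ultimately show ?case unfolding pow Legendre_mult[OF assms(1,2)] by simp
qed

lemma cong_power_prime:
  fixes x :: int
  assumes "prime q"
  shows "[x ^ q = x] (mod int q)"
proof -
  have q0: "q > 0" using assms by (simp add: prime_gt_0_nat)
  define b where "b = nat (x mod int q)"
  have b: "int b = x mod int q" using q0 by (simp add: b_def)
  have "[b ^ q = b] (mod q)"
  proof (cases "q dvd b")
    case True
    moreover have "b dvd b ^ q" using q0 by (intro dvd_power) simp
    ultimately have "q dvd b ^ q" by (rule dvd_trans)
    then show ?thesis using True by (simp add: cong_def mod_eq_0_iff_dvd)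
  next
    case False
    then have "[b * b ^ (q - 1) = b * 1] (mod q)"
      by (intro cong_mult cong_refl fermat_theorem assms)
    then show ?thesis using q0 by (simp add: power_eq_if)
  qed
  then have "[int b ^ q = int b] (mod int q)" by (metis cong_int_iff of_nat_power)
  then show ?thesis unfolding b by (simp add: cong_def power_mod)
qed

lemma fermat_coprime:
  fixes x :: int
  assumes "prime q" "coprime x (int q)"
  shows "[x ^ (q - 1) = 1] (mod int q)"
proof -
  have "[x * x ^ (q - 1) = x * 1] (mod int q)"
    using cong_power_prime[OF assms(1), of x] prime_gt_0_nat[OF assms(1)] by (simp flip: power_Suc)
  then show ?thesis using cong_mult_lcancel[OF assms(2)] by blast
qed

section \<open>Orbits of prime length, and the sign of a permutation commuting with an involution\<close>

text \<open>A map whose \<open>q\<close>-th iterate is the identity has orbits of length 1 or \<open>q\<close>, and an invariant weight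
  contributes a multiple of \<open>q\<close> on each long orbit. This is the counting argument behind Cauchy's
  theorem; here it replaces the additivity of the Frobenius map of the group ring.\<close>
lemma sum_cong_fixpoints:
  fixes w :: "'a \<Rightarrow> int" and q :: nat
  assumes "finite X" "prime q" "\<And>x. x \<in> X \<Longrightarrow> \<rho> x \<in> X"
    and "\<And>x. x \<in> X \<Longrightarrow> (\<rho> ^^ q) x = x" "\<And>x. x \<in> X \<Longrightarrow> w (\<rho> x) = w x"
  shows "[sum w X = sum w {x \<in> X. \<rho> x = x}] (mod int q)"
  using assms(1,3-5)
proof (induction X rule: finite_psubset_induct)
  case (psubset X)
  show ?case
  proof (cases "\<forall>x\<in>X. \<rho> x = x")
    case True
    then have "{x \<in> X. \<rho> x = x} = X" by blast
    then show ?thesis by simp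
  next
    case False
    then obtain x where x: "x \<in> X" "\<rho> x \<noteq> x" by blast
    have q0: "q > 0" using assms(2) by (simp add: prime_gt_0_nat)
    have fp: "(\<rho> ^^ i) ((\<rho> ^^ j) y) = (\<rho> ^^ (i + j)) y" for i j y
      by (simp add: funpow_add)
    have it: "(\<rho> ^^ i) y \<in> X" "w ((\<rho> ^^ i) y) = w y" if "y \<in> X" for i y
      using that by (induction i) (auto simp: psubset.prems)
    have per: "(\<rho> ^^ (q * v)) y = y" if "y \<in> X" for y v
      using that by (induction v) (simp_all add: funpow_add psubset.prems)
    have period: "\<rho> y = y" if y: "y \<in> X" and d: "(\<rho> ^^ d) y = y" "coprime d q" for y d
    proof (cases "d = 0")
      case True
      then show ?thesis using d(2) assms(2) by auto
    next
      case False
      then obtain u v where uv: "d * u = q * v + 1"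
        using bezout_nat[of d q] d(2) by auto
      have "(\<rho> ^^ (d * u)) y = y"
        by (induction u) (simp_all add: funpow_add d)
      then show ?thesis using per[OF y, of v] unfolding uv by simp
    qed
    define Q where "Q = (\<lambda>i. (\<rho> ^^ i) x) ` {..<q}"
    have inj: "inj_on (\<lambda>i. (\<rho> ^^ i) x) {..<q}"
    proof (rule linorder_inj_onI)
      fix i j assume ij: "i < j" "i \<in> {..<q}" "j \<in> {..<q}"
      show "(\<rho> ^^ i) x \<noteq> (\<rho> ^^ j) x"
      proof
        assume eq: "(\<rho> ^^ i) x = (\<rho> ^^ j) x"
        have "(\<rho> ^^ (j - i)) ((\<rho> ^^ i) x) = (\<rho> ^^ j) x"
          using ij by (simp add: fp)
        moreover have "coprime (j - i) q"
          using ij assms(2) by (auto simp: coprime_commute[of _ q] intro!: prime_imp_coprime dest!: dvd_imp_le)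
        ultimately have "\<rho> ((\<rho> ^^ i) x) = (\<rho> ^^ i) x"
          using period[OF it(1)[OF x(1)]] eq by simp
        then have "(\<rho> ^^ (q - i)) (\<rho> ((\<rho> ^^ i) x)) = (\<rho> ^^ (q - i)) ((\<rho> ^^ i) x)" by simp
        moreover have "(\<rho> ^^ (q - i)) ((\<rho> ^^ i) x) = x"
          using ij psubset.prems(2)[OF x(1)] by (simp add: fp)
        moreover have "(\<rho> ^^ (q - i)) (\<rho> ((\<rho> ^^ i) x)) = \<rho> ((\<rho> ^^ (q - i)) ((\<rho> ^^ i) x))"
          by (metis funpow_swap1)
        ultimately show False using x by simp
      qed
    qed auto
    have QX: "Q \<subseteq> X" using it x by (auto simp: Q_def)
    have QnF: "\<rho> y \<noteq> y" if y: "y \<in> Q" for y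
    proof
      assume eq: "\<rho> y = y"
      obtain i where i: "i < q" "y = (\<rho> ^^ i) x" using y by (auto simp: Q_def)
      have "(\<rho> ^^ (q - i)) y = x"
        using i psubset.prems(2)[OF x(1)] by (simp add: fp)
      moreover have "(\<rho> ^^ j) y = y" for j by (induction j) (simp_all add: eq)
      ultimately show False using eq x by simp
    qed
    have Qclosed: "\<rho> y \<in> Q" if y: "y \<in> Q" for y
    proof -
      obtain i where i: "i < q" "y = (\<rho> ^^ i) x" using y by (auto simp: Q_def)
      have "\<rho> y = (\<rho> ^^ (Suc i mod q)) x"
      proof (cases "Suc i = q")
        case True
        then show ?thesis using i psubset.prems(2)[OF x(1)] by auto
      next
        case False
        then show ?thesis using i by simp
      qed
      moreover have "Suc i mod q < q" using q0 by simp
      ultimately show ?thesis by (auto simp: Q_def)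
    qed
    have Qback: "y \<in> Q" if y: "y \<in> X" and *: "\<rho> y \<in> Q" for y
    proof -
      have "(\<rho> ^^ j) (\<rho> y) \<in> Q" for j
        using * Qclosed by (induction j) auto
      moreover have "(\<rho> ^^ (q - 1)) (\<rho> y) = y"
        using psubset.prems(2)[OF y] q0 by (metis Suc_diff_1 comp_apply funpow_Suc_right)
      ultimately show ?thesis by metis
    qed
    have "x \<in> Q" using q0 by (auto simp: Q_def image_iff intro!: bexI[of _ 0])
    then have "X - Q \<subset> X" using x by blast
    then have IH: "[sum w (X - Q) = sum w {y \<in> X - Q. \<rho> y = y}] (mod int q)"
      using Qback by (intro psubset.IH) (auto simp: psubset.prems)
    have "sum w X = sum w (X - Q) + sum w Q"
      using QX psubset.hyps by (simp add: sum.subset_diff)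
    also have "sum w Q = int q * w x"
      unfolding Q_def using it(2)[OF x(1)] by (simp add: sum.reindex[OF inj])
    finally have 1: "sum w X = sum w (X - Q) + int q * w x" .
    have 2: "{y \<in> X - Q. \<rho> y = y} = {y \<in> X. \<rho> y = y}" using QnF by blast
    show ?thesis using IH unfolding 1 2 by (simp add: cong_def)
  qed
qed

text \<open>Gauss's lemma for permutations. If \<open>\<sigma>\<close> preserves the half \<open>A\<close>, it acts in the same way on \<open>A\<close> and
  on \<open>\<iota> ` A\<close>, so its sign is a square. In general each element of \<open>A\<close> that \<open>\<sigma>\<close> sends to the other half is
  repaired by composing with one transposition that commutes with \<open>\<iota>\<close>.\<close>
lemma sign_commuting_with_involution:
  fixes \<sigma> \<iota> :: "'a \<Rightarrow> 'a"
  assumes "finite A" "\<sigma> permutes X" "X = insert z (A \<union> \<iota> ` A)" "z \<notin> A" "z \<notin> \<iota> ` A"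
    and "A \<inter> \<iota> ` A = {}" "\<And>x. x \<in> X \<Longrightarrow> \<iota> (\<iota> x) = x" "\<And>x. x \<in> X \<Longrightarrow> \<sigma> (\<iota> x) = \<iota> (\<sigma> x)"
    and "\<sigma> z = z" "\<iota> z = z"
  shows "sign \<sigma> = (- 1) ^ card {x \<in> A. \<sigma> x \<in> \<iota> ` A}"
  using assms(2,8,9)
proof (induction "card {x \<in> A. \<sigma> x \<in> \<iota> ` A}" arbitrary: \<sigma>)
  case 0
  have finX: "finite X" using assms by simp
  have inX: "\<sigma> x \<in> X \<longleftrightarrow> x \<in> X" for x using 0 permutes_in_image by metis
  have iX: "\<iota> x \<in> X" if "x \<in> X" for x
    using that assms(3,7,10) by (auto simp: image_iff)
  have injs: "\<sigma> x = \<sigma> y \<longleftrightarrow> x = y" for x y using 0 permutes_inj by (metis inj_eq)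
  have sA: "\<sigma> x \<in> A" if "x \<in> A" for x
  proof -
    have "\<sigma> x \<notin> \<iota> ` A" using 0 that assms(1) by auto
    moreover have "\<sigma> x \<noteq> z" using injs[of x z] 0 that assms(4) by auto
    ultimately show ?thesis using inX[of x] that assms(3) by auto
  qed
  define \<alpha> where "\<alpha> = restrict_id \<sigma> A"
  have "\<sigma> ` A = A" using sA assms(1) by (intro endo_inj_surj) (auto simp: inj_on_def injs)
  then have "bij_betw \<sigma> A A" by (auto simp: bij_betw_def inj_on_def injs)
  then have \<alpha>: "\<alpha> permutes A" unfolding \<alpha>_def by (rule permutes_restrict_id)
  have inji: "inj_on \<iota> A" using assms(3,7) by (metis UnI1 inj_on_inverseI insertI2)
  have \<beta>: "map_permutation A \<iota> \<alpha> permutes \<iota> ` A"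
    by (rule map_permutation_permutes) (use \<alpha> inji in \<open>auto simp: bij_betw_def\<close>)
  have eq: "\<sigma> = \<alpha> \<circ> map_permutation A \<iota> \<alpha>"
  proof
    fix x
    consider "x \<in> A" | y where "y \<in> A" "x = \<iota> y" | "x = z" | "x \<notin> X" using assms(3) by blast
    then show "\<sigma> x = (\<alpha> \<circ> map_permutation A \<iota> \<alpha>) x"
    proof cases
      case 1
      then have "map_permutation A \<iota> \<alpha> x = x" using assms(6) by (intro permutes_not_in[OF \<beta>]) auto
      then show ?thesis using 1 by (simp add: \<alpha>_def)
    next
      case 2
      then have "map_permutation A \<iota> \<alpha> x = \<iota> (\<sigma> y)"
        using map_permutation_apply[OF inji] by (simp add: \<alpha>_def)
      moreover have "\<iota> (\<sigma> y) \<notin> A" using sA 2 assms(6) by auto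
      ultimately show ?thesis using 2 0 assms(3) by (simp add: \<alpha>_def)
    next
      case 3
      then have "map_permutation A \<iota> \<alpha> x = x" using assms(5) by (intro permutes_not_in[OF \<beta>]) auto
      then show ?thesis using 3 assms(4) 0 by (simp add: \<alpha>_def)
    next
      case 4
      then have "map_permutation A \<iota> \<alpha> x = x" using assms(3) by (intro permutes_not_in[OF \<beta>]) auto
      then show ?thesis using 4 assms(3) 0(2) by (simp add: \<alpha>_def permutes_not_in)
    qed
  qed
  have p: "permutation \<alpha>" "permutation (map_permutation A \<iota> \<alpha>)"
    using \<alpha> \<beta> assms(1) by (auto intro: permutes_imp_permutation)
  have "sign (map_permutation A \<iota> \<alpha>) = sign \<alpha>"
    using evenperm_map_permutation[OF inji \<alpha> assms(1)] by (simp add: sign_def)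
  then have "sign \<sigma> = 1" unfolding eq sign_compose[OF p] by simp
  then show ?case using 0 by simp
next
  case (Suc b)
  have finX: "finite X" using assms by simp
  then have "{x \<in> A. \<sigma> x \<in> \<iota> ` A} \<noteq> {}" using Suc.hyps(2) by (metis card.empty nat.distinct(1))
  then obtain x where x: "x \<in> A" "\<sigma> x \<in> \<iota> ` A" by blast
  define y where "y = \<iota> (\<sigma> x)"
  have yA: "y \<in> A" and sx: "\<sigma> x = \<iota> y" using x assms(3,7) by (auto simp: y_def)
  have injs: "\<sigma> u = \<sigma> v \<longleftrightarrow> u = v" for u v using Suc.prems permutes_inj by (metis inj_eq)
  have sxX: "\<sigma> u \<in> X \<longleftrightarrow> u \<in> X" for u using Suc.prems permutes_in_image by metis
  have iA: "\<iota> y \<in> \<iota> ` A" using yA by simp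
  have yX: "y \<in> X" "\<iota> y \<in> X" using yA assms(3) by auto
  have yne: "y \<noteq> \<iota> y" using yA iA assms(6) by auto
  have yz: "y \<noteq> z" "\<iota> y \<noteq> z" using yA iA assms(4,5) by auto
  \<comment> \<open>Swapping \<open>y\<close> with \<open>\<iota> y\<close> brings the image of \<open>x\<close> back to \<open>A\<close> and affects no other element of \<open>A\<close>: the only
      candidate, the preimage of \<open>y\<close>, is \<open>\<iota> x\<close>.\<close>
  define \<tau> where "\<tau> = transpose y (\<iota> y) \<circ> \<sigma>"
  have t: "\<tau> permutes X" unfolding \<tau>_def using Suc.prems yX
    by (intro permutes_compose permutes_swap_id)
  have iinj: "\<iota> u = \<iota> v \<longleftrightarrow> u = v" if "u \<in> X" "v \<in> X" for u v
    using that assms(7) by metis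
  have tc: "transpose y (\<iota> y) (\<iota> u) = \<iota> (transpose y (\<iota> y) u)" if "u \<in> X" for u
    using that yX iinj[OF that yX(1)] iinj[OF that yX(2)] assms(7)[OF yX(1)]
    by (auto simp: transpose_def)
  have comm: "\<tau> (\<iota> u) = \<iota> (\<tau> u)" if "u \<in> X" for u
    using that Suc.prems sxX tc by (simp add: \<tau>_def)
  have tz: "\<tau> z = z" using Suc.prems yz by (simp add: \<tau>_def)
  have set: "{x \<in> A. \<sigma> x \<in> \<iota> ` A} = insert x {x \<in> A. \<tau> x \<in> \<iota> ` A}" "x \<notin> {x \<in> A. \<tau> x \<in> \<iota> ` A}"
  proof -
    have tx: "\<tau> x = y" by (simp add: \<tau>_def sx)
    show "x \<notin> {x \<in> A. \<tau> x \<in> \<iota> ` A}" using tx yA assms(6) by auto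
    have "\<tau> u = \<sigma> u" if u: "u \<in> A" "u \<noteq> x" for u
    proof -
      have "\<sigma> u \<noteq> \<iota> y" using injs[of u x] u sx by simp
      moreover have "\<sigma> u \<noteq> y"
      proof
        assume "\<sigma> u = y"
        then have "\<sigma> u = \<sigma> (\<iota> x)" using Suc.prems(2)[of x] x assms(3) by (simp add: y_def)
        then show False using injs u x assms(6) by auto
      qed
      ultimately show ?thesis by (simp add: \<tau>_def)
    qed
    then have "u \<in> A \<and> \<sigma> u \<in> \<iota> ` A \<longleftrightarrow> u = x \<or> (u \<in> A \<and> \<tau> u \<in> \<iota> ` A)" for u
      using x by (cases "u = x") auto
    then show "{x \<in> A. \<sigma> x \<in> \<iota> ` A} = insert x {x \<in> A. \<tau> x \<in> \<iota> ` A}" by blast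
  qed
  have c: "card {x \<in> A. \<sigma> x \<in> \<iota> ` A} = Suc (card {x \<in> A. \<tau> x \<in> \<iota> ` A})"
    using set assms(1) by simp
  have "sign \<tau> = (- 1) ^ card {x \<in> A. \<tau> x \<in> \<iota> ` A}"
    using Suc.hyps(1)[of \<tau>] c Suc.hyps(2) t comm tz by simp
  moreover have "sign \<tau> = - sign \<sigma>"
    unfolding \<tau>_def using yne Suc.prems finX
    by (subst sign_compose) (auto simp: sign_swap_id permutation_swap_id intro: permutes_imp_permutation)
  ultimately show ?case unfolding c by simp
qed

section \<open>Determinants\<close>

lemma det_cong_mod:
  fixes A B :: "int mat"
  assumes "A \<in> carrier_mat n n" "B \<in> carrier_mat n n"
    and "\<And>i j. i < n \<Longrightarrow> j < n \<Longrightarrow> [A $$ (i, j) = B $$ (i, j)] (mod m)"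
  shows "[det A = det B] (mod m)"
  unfolding det_def'[OF assms(1)] det_def'[OF assms(2)]
proof (intro cong_sum cong_mult cong_refl cong_prod)
  fix p i assume "p \<in> {p. p permutes {0..<n}}" "i \<in> {0..<n}"
  then show "[A $$ (i, p i) = B $$ (i, p i)] (mod m)"
    using assms(3) permutes_in_image[of p "{0..<n}" i] by auto
qed

lemma det_scale_rows:
  fixes B :: "'a :: comm_ring_1 mat"
  assumes "B \<in> carrier_mat n n"
  shows "det (mat n n (\<lambda>(i, j). c i * B $$ (i, j))) = (\<Prod>i<n. c i) * det B"
proof -
  have "det (mat n n (\<lambda>(i, j). c i * B $$ (i, j)))
      = (\<Sum>p | p permutes {0..<n}. signof p * (\<Prod>i = 0..<n. c i * B $$ (i, p i)))"
    unfolding det_def'[OF mat_carrier]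
    by (intro sum.cong refl arg_cong2[of _ _ _ _ "(*)"] prod.cong) (auto simp: permutes_in_image)
  also have "\<dots> = (\<Prod>i<n. c i) * det B"
    unfolding det_def'[OF assms] sum_distrib_left
    by (intro sum.cong refl) (simp add: prod.distrib atLeast0LessThan mult.left_commute)
  finally show ?thesis .
qed

text \<open>The two permutations contribute the same sign, so no sign appears.\<close>
lemma det_permute_both:
  fixes A :: "'a :: idom mat"
  assumes "A \<in> carrier_mat n n" "\<And>i. i < n \<Longrightarrow> \<pi> i < n" "inj_on \<pi> {..<n}"
  shows "det (mat n n (\<lambda>(i, j). A $$ (\<pi> i, \<pi> j))) = det A"
proof -
  define P where "P = mat n n (\<lambda>(i, j). of_bool (j = \<pi> i) :: 'a)"
  have P: "P \<in> carrier_mat n n" by (simp add: P_def)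
  have "P * transpose_mat P = 1\<^sub>m n"
  proof (rule eq_matI)
    fix i j assume "i < dim_row (1\<^sub>m n)" "j < dim_col (1\<^sub>m n)"
    then have ij: "i < n" "j < n" by auto
    have "(\<Sum>k = 0..<n. of_bool (k = \<pi> i) * of_bool (k = \<pi> j)) = (\<Sum>k = 0..<n. if k = \<pi> i then of_bool (k = \<pi> j) else (0 :: 'a))"
      by (intro sum.cong) auto
    also have "\<dots> = of_bool (\<pi> i = \<pi> j)" using ij assms(2) by simp
    also have "\<pi> i = \<pi> j \<longleftrightarrow> i = j" using ij assms(3) by (auto dest: inj_onD)
    finally show "(P * transpose_mat P) $$ (i, j) = 1\<^sub>m n $$ (i, j)"
      using ij by (simp add: P_def scalar_prod_def)
  qed (simp_all add: P_def)
  then have d: "det P * det P = 1"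
    using det_mult[OF P, of "transpose_mat P"] det_transpose[OF P] P by simp
  have "mat n n (\<lambda>(i, j). A $$ (\<pi> i, \<pi> j)) = P * A * transpose_mat P"
  proof (rule eq_matI)
    fix i j assume "i < dim_row (P * A * transpose_mat P)" "j < dim_col (P * A * transpose_mat P)"
    then have ij: "i < n" "j < n" using P by auto
    have PA: "(P * A) $$ (i, k) = A $$ (\<pi> i, k)" if k: "k < n" for k
    proof -
      have "(P * A) $$ (i, k) = (\<Sum>l = 0..<n. if l = \<pi> i then A $$ (l, k) else 0)"
        using ij k assms(1) by (simp add: P_def scalar_prod_def)
      then show ?thesis using assms(2)[OF ij(1)] by simp
    qed
    have "(P * A * transpose_mat P) $$ (i, j) = (\<Sum>l = 0..<n. (P * A) $$ (i, l) * P $$ (j, l))"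
      using ij P assms(1) by (simp add: scalar_prod_def del: assoc_mult_mat)
    also have "\<dots> = (\<Sum>l = 0..<n. if l = \<pi> j then A $$ (\<pi> i, l) else 0)"
      using ij PA by (intro sum.cong) (auto simp: P_def)
    also have "\<dots> = A $$ (\<pi> i, \<pi> j)" using assms(2)[OF ij(2)] by simp
    finally show "mat n n (\<lambda>(i, j). A $$ (\<pi> i, \<pi> j)) $$ (i, j) = (P * A * transpose_mat P) $$ (i, j)"
      using ij by simp
  qed (use P in auto)
  then have "det (mat n n (\<lambda>(i, j). A $$ (\<pi> i, \<pi> j))) = det P * det A * det P"
    using P assms(1) by (simp add: det_mult[of _ n] det_transpose[OF P])
  then show ?thesis using d by (simp add: mult.commute mult.left_commute)
qed

section \<open>The ring of integral class functions\<close>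

context group
begin

text \<open>The value 0 outside the carrier makes associativity and, for class functions, commutativity
  genuine equations between functions, which can be used for rewriting.\<close>
definition conv :: "('a \<Rightarrow> int) \<Rightarrow> ('a \<Rightarrow> int) \<Rightarrow> 'a \<Rightarrow> int"
  where "conv f h = (\<lambda>g. if g \<in> carrier G then \<Sum>x\<in>carrier G. f x * h (inv x \<otimes> g) else 0)"

definition class_fun :: "('a \<Rightarrow> int) \<Rightarrow> bool"
  where "class_fun f \<longleftrightarrow> (\<forall>g. g \<notin> carrier G \<longrightarrow> f g = 0) \<and>
    (\<forall>g\<in>carrier G. \<forall>x\<in>carrier G. f (x \<otimes> g \<otimes> inv x) = f g)"

text \<open>Parity \<open>1\<close> means even under inversion and parity \<open>-1\<close> means odd; as a factor, it is multiplicative under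
  convolution.\<close>
definition parity :: "int \<Rightarrow> ('a \<Rightarrow> int) \<Rightarrow> bool"
  where "parity c f \<longleftrightarrow> class_fun f \<and> (\<forall>g\<in>carrier G. f (inv g) = c * f g)"

definition unit_fun :: "'a \<Rightarrow> int"
  where "unit_fun g = of_bool (g = \<one>)"

text \<open>The sum of all group elements, seen in the group ring.\<close>
definition norm_fun :: "'a \<Rightarrow> int"
  where "norm_fun g = of_bool (g \<in> carrier G)"

text \<open>The augmentation homomorphism of the group ring.\<close>
definition aug :: "('a \<Rightarrow> int) \<Rightarrow> int"
  where "aug f = sum f (carrier G)"

primrec cpow :: "('a \<Rightarrow> int) \<Rightarrow> nat \<Rightarrow> 'a \<Rightarrow> int"
  where "cpow f 0 = unit_fun"
  | "cpow f (Suc k) = conv f (cpow f k)"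

definition fun_cong :: "('a \<Rightarrow> int) \<Rightarrow> ('a \<Rightarrow> int) \<Rightarrow> nat \<Rightarrow> bool"
  where "fun_cong f h q \<longleftrightarrow> (\<forall>g\<in>carrier G. [f g = h g] (mod int q))"

lemma sum_translate:
  assumes "y \<in> carrier G"
  shows "(\<Sum>x\<in>carrier G. F (y \<otimes> x)) = (\<Sum>x\<in>carrier G. F x)"
  by (rule sum.reindex_bij_witness[where i = "\<lambda>x. inv y \<otimes> x" and j = "\<lambda>x. y \<otimes> x"])
    (use assms in \<open>auto simp flip: m_assoc\<close>)

lemma sum_inverse: "(\<Sum>x\<in>carrier G. F (inv x)) = (\<Sum>x\<in>carrier G. F x)"
  by (rule sum.reindex_bij_witness[where i = "\<lambda>x. inv x" and j = "\<lambda>x. inv x"]) auto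

lemma class_funD:
  assumes "class_fun f" "g \<in> carrier G" "x \<in> carrier G"
  shows "f (x \<otimes> g \<otimes> inv x) = f g"
  using assms by (auto simp: class_fun_def)

lemma class_fun_mult_commute:
  assumes "class_fun f" "x \<in> carrier G" "y \<in> carrier G"
  shows "f (x \<otimes> y) = f (y \<otimes> x)"
  using class_funD[OF assms(1), of "x \<otimes> y" y] assms(2,3) by (simp add: m_assoc)

lemma class_fun_on_class:
  assumes "class_fun f" "g \<in> carrier G" "x \<in> conj_class G g"
  shows "f x = f g"
  using assms by (auto simp: conj_class_eq class_funD)

lemma conv_assoc: "conv (conv f h) k = conv f (conv h k)"
proof
  fix g
  show "conv (conv f h) k g = conv f (conv h k) g"
  proof (cases "g \<in> carrier G")
    case True
    have "conv (conv f h) k g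
        = (\<Sum>x\<in>carrier G. \<Sum>y\<in>carrier G. f y * h (inv y \<otimes> x) * k (inv x \<otimes> g))"
      using True by (simp add: conv_def sum_distrib_right)
    also have "\<dots> = (\<Sum>y\<in>carrier G. f y * (\<Sum>x\<in>carrier G. h (inv y \<otimes> x) * k (inv x \<otimes> g)))"
      by (subst sum.swap) (simp add: sum_distrib_left mult.assoc)
    also have "\<dots> = (\<Sum>y\<in>carrier G. f y * (\<Sum>x\<in>carrier G. h x * k (inv x \<otimes> (inv y \<otimes> g))))"
    proof (rule sum.cong[OF refl])
      fix y assume y: "y \<in> carrier G"
      have "(\<Sum>x\<in>carrier G. h (inv y \<otimes> x) * k (inv x \<otimes> g))
          = (\<Sum>x\<in>carrier G. h (inv y \<otimes> (y \<otimes> x)) * k (inv (y \<otimes> x) \<otimes> g))"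
        by (rule sum_translate[OF y, symmetric])
      also have "\<dots> = (\<Sum>x\<in>carrier G. h x * k (inv x \<otimes> (inv y \<otimes> g)))"
        using y True by (intro sum.cong refl) (simp add: inv_mult_cancel inv_mult_group m_assoc)
      finally show "f y * (\<Sum>x\<in>carrier G. h (inv y \<otimes> x) * k (inv x \<otimes> g))
          = f y * (\<Sum>x\<in>carrier G. h x * k (inv x \<otimes> (inv y \<otimes> g)))" by simp
    qed
    also have "\<dots> = conv f (conv h k) g"
      using True by (simp add: conv_def)
    finally show ?thesis .
  qed (simp add: conv_def)
qed

lemma conv_comm:
  assumes "class_fun h"
  shows "conv f h = conv h f"
proof
  fix g
  show "conv f h g = conv h f g"
  proof (cases "g \<in> carrier G")
    case True
    have "(\<Sum>x\<in>carrier G. f x * h (inv x \<otimes> g)) = (\<Sum>y\<in>carrier G. h y * f (inv y \<otimes> g))"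
    proof (rule sum.reindex_bij_witness[where i = "\<lambda>y. inv y \<otimes> g" and j = "\<lambda>x. g \<otimes> inv x"])
      fix x assume x: "x \<in> carrier G"
      then show "inv (g \<otimes> inv x) \<otimes> g = x" "g \<otimes> inv (inv x \<otimes> g) = x"
        using True by (simp_all add: inv_mult_group m_assoc flip: m_assoc[of g "inv g"])
      then show "h (g \<otimes> inv x) * f (inv (g \<otimes> inv x) \<otimes> g) = f x * h (inv x \<otimes> g)"
        using x True class_fun_mult_commute[OF assms, of g "inv x"] by simp
    qed (use True in auto)
    then show ?thesis using True by (simp add: conv_def)
  qed (simp add: conv_def)
qed

lemma class_fun_conv:
  assumes "class_fun f" "class_fun h"
  shows "class_fun (conv f h)"
  unfolding class_fun_def
proof (intro conjI allI impI ballI)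
  fix g x assume gx: "g \<in> carrier G" "x \<in> carrier G"
  have "conv f h (x \<otimes> g \<otimes> inv x) = (\<Sum>y\<in>carrier G. f y * h (inv y \<otimes> (x \<otimes> g \<otimes> inv x)))"
    using gx by (simp add: conv_def)
  also have "\<dots> = (\<Sum>y\<in>carrier G. f (x \<otimes> y \<otimes> inv x) * h (inv (x \<otimes> y \<otimes> inv x) \<otimes> (x \<otimes> g \<otimes> inv x)))"
    by (rule sum.reindex_bij_witness[where j = "\<lambda>y. inv x \<otimes> y \<otimes> x" and i = "\<lambda>y. x \<otimes> y \<otimes> inv x"])
      (use gx in \<open>auto simp: m_assoc inv_mult_cancel simp flip: m_assoc[of x "inv x"]\<close>)
  also have "\<dots> = (\<Sum>y\<in>carrier G. f y * h (inv y \<otimes> g))"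
  proof (rule sum.cong[OF refl])
    fix y assume y: "y \<in> carrier G"
    have "inv (x \<otimes> y \<otimes> inv x) \<otimes> (x \<otimes> g \<otimes> inv x) = x \<otimes> (inv y \<otimes> g) \<otimes> inv x"
      using gx y by (simp add: inv_mult_group m_assoc inv_mult_cancel)
    then show "f (x \<otimes> y \<otimes> inv x) * h (inv (x \<otimes> y \<otimes> inv x) \<otimes> (x \<otimes> g \<otimes> inv x)) = f y * h (inv y \<otimes> g)"
      using gx y class_funD[OF assms(1)] class_funD[OF assms(2)] by simp
  qed
  finally show "conv f h (x \<otimes> g \<otimes> inv x) = conv f h g"
    using gx by (simp add: conv_def)
qed (simp add: conv_def)

lemma conv_add: "conv f (\<lambda>x. h x + k x) = (\<lambda>g. conv f h g + conv f k g)"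
  by (auto simp: conv_def distrib_left sum.distrib)

lemma conv_scale: "conv f (\<lambda>x. c * h x) = (\<lambda>g. c * conv f h g)"
  by (simp add: conv_def sum_distrib_left mult.left_commute fun_eq_iff)

lemma conv_diff: "conv f (\<lambda>x. h x - k x) = (\<lambda>g. conv f h g - conv f k g)"
  by (auto simp: conv_def right_diff_distrib sum_subtractf)

lemma conv_sum: "conv f (\<lambda>x. \<Sum>a\<in>A. c a * s a x) g = (\<Sum>a\<in>A. c a * conv f (s a) g)"
proof (cases "g \<in> carrier G")
  case True
  then have "conv f (\<lambda>x. \<Sum>a\<in>A. c a * s a x) g
      = (\<Sum>x\<in>carrier G. \<Sum>a\<in>A. c a * (f x * s a (inv x \<otimes> g)))"
    by (simp add: conv_def sum_distrib_left algebra_simps)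
  also have "\<dots> = (\<Sum>a\<in>A. c a * conv f (s a) g)"
    using True by (subst sum.swap) (simp add: conv_def sum_distrib_left)
  finally show ?thesis .
qed (simp add: conv_def)

lemma conv_at_one: "conv f h \<one> = (\<Sum>x\<in>carrier G. f x * h (inv x))"
  by (simp add: conv_def)

lemma parity_class_fun: "parity c f \<Longrightarrow> class_fun f"
  by (simp add: parity_def)

lemma parity_conv:
  assumes "parity c f" "parity d h"
  shows "parity (c * d) (conv f h)"
  unfolding parity_def
proof (intro conjI ballI)
  show "class_fun (conv f h)" using assms by (simp add: parity_def class_fun_conv)
  fix g assume g: "g \<in> carrier G"
  have "conv f h (inv g) = (\<Sum>x\<in>carrier G. f (inv x) * h (inv (inv x) \<otimes> inv g))"
    using g sum_inverse[of "\<lambda>x. f x * h (inv x \<otimes> inv g)"] by (simp add: conv_def)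
  also have "\<dots> = (\<Sum>x\<in>carrier G. c * d * (f x * h (inv x \<otimes> g)))"
  proof (rule sum.cong[OF refl])
    fix x assume x: "x \<in> carrier G"
    have "inv (inv x) \<otimes> inv g = inv (g \<otimes> inv x)" using x g by (simp add: inv_mult_group)
    then have "h (inv (inv x) \<otimes> inv g) = d * h (g \<otimes> inv x)"
      using assms(2) x g unfolding parity_def by (metis inv_closed m_closed)
    also have "h (g \<otimes> inv x) = h (inv x \<otimes> g)"
      using class_fun_mult_commute[OF parity_class_fun[OF assms(2)]] x g by simp
    finally show "f (inv x) * h (inv (inv x) \<otimes> inv g) = c * d * (f x * h (inv x \<otimes> g))"
      using assms(1) x by (simp add: parity_def)
  qed
  finally show "conv f h (inv g) = c * d * conv f h g"
    using g by (simp add: conv_def sum_distrib_left)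
qed

lemma class_fun_unit: "class_fun unit_fun"
proof -
  have "g = \<one>" if "x \<otimes> g \<otimes> inv x = \<one>" "g \<in> carrier G" "x \<in> carrier G" for g x
  proof -
    have "g = inv x \<otimes> (x \<otimes> g \<otimes> inv x) \<otimes> x"
      using that(2,3) by (simp add: m_assoc inv_mult_cancel)
    then show ?thesis using that by simp
  qed
  then show ?thesis by (auto simp: class_fun_def unit_fun_def)
qed

lemma parity_unit: "parity 1 unit_fun"
  by (auto simp: parity_def class_fun_unit unit_fun_def)

lemma parity_norm: "parity 1 norm_fun"
  by (auto simp: parity_def class_fun_def norm_fun_def)

lemma parity_cpow:
  assumes "parity c f"
  shows "parity (c ^ k) (cpow f k)"
  by (induction k) (use parity_unit parity_conv[OF assms] in auto)

lemma class_fun_cpow: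
  assumes "class_fun f"
  shows "class_fun (cpow f k)"
  by (induction k) (use class_fun_unit class_fun_conv[OF assms] in auto)

lemma conv_unit:
  assumes "class_fun f" "finite (carrier G)"
  shows "conv f unit_fun = f" "conv unit_fun f = f"
proof -
  have "conv f unit_fun g = f g" for g
  proof (cases "g \<in> carrier G")
    case True
    have "(\<Sum>x\<in>carrier G. f x * unit_fun (inv x \<otimes> g)) = (\<Sum>x\<in>carrier G. if x = g then f x else 0)"
    proof (rule sum.cong[OF refl])
      fix x assume x: "x \<in> carrier G"
      have "inv x \<otimes> g = \<one> \<longleftrightarrow> x = g"
        using x True by (metis inv_closed inv_equality inv_inv l_inv)
      then show "f x * unit_fun (inv x \<otimes> g) = (if x = g then f x else 0)"
        by (simp add: unit_fun_def)
    qed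
    then show ?thesis using True assms(2) by (simp add: conv_def)
  next
    case False
    then show ?thesis using assms(1) by (simp add: conv_def class_fun_def)
  qed
  then show "conv f unit_fun = f" by blast
  then show "conv unit_fun f = f" using conv_comm[OF assms(1), of unit_fun] by simp
qed

lemma conv_left_comm:
  assumes "class_fun f" "class_fun h"
  shows "conv f (conv h k) = conv h (conv f k)"
  by (metis assms conv_assoc conv_comm)

lemma cpow_add:
  assumes "class_fun f" "finite (carrier G)"
  shows "cpow f (j + k) = conv (cpow f j) (cpow f k)"
  by (induction j) (simp_all add: conv_assoc conv_unit[OF class_fun_cpow[OF assms(1)] assms(2)])

lemma cpow_mult:
  assumes "class_fun f" "finite (carrier G)"
  shows "cpow f (j * k) = cpow (cpow f j) k"
  by (induction k) (simp_all add: cpow_add[OF assms])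

lemma cpow_conv:
  assumes "class_fun f" "class_fun h" "finite (carrier G)"
  shows "cpow (conv f h) k = conv (cpow f k) (cpow h k)"
proof (induction k)
  case 0
  then show ?case by (simp add: conv_unit[OF class_fun_unit assms(3)])
next
  case (Suc k)
  have "conv h (conv (cpow f k) (cpow h k)) = conv (cpow f k) (conv h (cpow h k))"
    by (rule conv_left_comm[OF assms(2) class_fun_cpow[OF assms(1)]])
  then show ?case by (simp add: Suc conv_assoc)
qed

text \<open>The norm element spans an ideal on which the ring acts through the augmentation. In particular odd
  class functions, whose augmentation vanishes, annihilate it.\<close>
lemma conv_norm:
  shows "conv f norm_fun = (\<lambda>g. aug f * norm_fun g)"
  by (auto simp: conv_def norm_fun_def aug_def)

lemma aug_conv: "aug (conv f h) = aug f * aug h"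
proof -
  have "aug (conv f h) = (\<Sum>x\<in>carrier G. f x * (\<Sum>g\<in>carrier G. h (inv x \<otimes> g)))"
    unfolding aug_def conv_def by (simp add: sum_distrib_left) (rule sum.swap)
  also have "\<dots> = (\<Sum>x\<in>carrier G. f x * aug h)"
    by (rule sum.cong) (simp_all add: aug_def sum_translate)
  finally show ?thesis by (simp add: aug_def sum_distrib_right)
qed

lemma aug_unit: "finite (carrier G) \<Longrightarrow> aug unit_fun = 1"
  by (simp add: aug_def unit_fun_def)

lemma aug_cpow: "finite (carrier G) \<Longrightarrow> aug (cpow f k) = aug f ^ k"
  by (induction k) (simp_all add: aug_unit aug_conv)

lemma aug_norm: "aug norm_fun = int (order G)"
  by (simp add: aug_def norm_fun_def order_def)

lemma aug_odd:
  assumes "parity (- 1) f"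
  shows "aug f = 0"
proof -
  have "aug f = (\<Sum>x\<in>carrier G. f (inv x))" by (simp add: aug_def sum_inverse)
  also have "\<dots> = - aug f" using assms by (simp add: aug_def parity_def sum_negf)
  finally show ?thesis by simp
qed

lemma fun_cong_refl [simp]: "fun_cong f f q"
  by (simp add: fun_cong_def)

lemma fun_cong_sym: "fun_cong f h q \<Longrightarrow> fun_cong h f q"
  by (auto simp: fun_cong_def intro: cong_sym)

lemma fun_cong_trans [trans]: "fun_cong f h q \<Longrightarrow> fun_cong h k q \<Longrightarrow> fun_cong f k q"
  unfolding fun_cong_def by (meson cong_trans)

lemma fun_cong_conv:
  assumes "fun_cong f f' q" "fun_cong h h' q"
  shows "fun_cong (conv f h) (conv f' h') q"
  using assms by (auto simp: fun_cong_def conv_def intro!: cong_sum cong_mult)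

lemma fun_cong_aug: "fun_cong f h q \<Longrightarrow> [aug f = aug h] (mod int q)"
  unfolding aug_def fun_cong_def by (intro cong_sum) auto

section \<open>Prime powers of class functions\<close>

lemma coprime_power_inverse:
  assumes "coprime q (order G)"
  obtains b where "\<And>x. x \<in> carrier G \<Longrightarrow> (x [^] q) [^] (b :: nat) = x"
proof -
  obtain b where b: "[q * b = 1] (mod order G)"
    using cong_solve_coprime_nat[OF assms] by auto
  define b' where "b' = b + order G"
  show ?thesis
  proof (cases "order G = 0")
    case True
    then have "q = 1" using assms by simp
    then show ?thesis by (intro that[of 1]) simp
  next
    case False
    have "q > 0 \<or> order G = 1" using assms by (cases "q = 0") auto
    show ?thesis
    proof (cases "order G = 1")
      case True
      then obtain z where "carrier G = {z}" unfolding order_def by (rule card_1_singletonE)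
      then have "carrier G = {\<one>}" using one_closed by simp
      then show ?thesis by (intro that[of 1]) simp
    next
      case False': False
      then have q0: "q > 0" using assms by (cases "q = 0") auto
      have "[q * b' = 1] (mod order G)" using b by (simp add: b'_def algebra_simps cong_def)
      moreover have "1 \<le> q * b'" using q0 False by (simp add: b'_def)
      ultimately obtain k where k: "q * b' = k * order G + 1" using cong_le_nat by blast
      have "(x [^] q) [^] b' = x" if x: "x \<in> carrier G" for x
      proof -
        have "x [^] (k * order G) = \<one>"
          using x pow_order_eq_1[OF x] by (metis mult.commute nat_pow_one nat_pow_pow)
        then show ?thesis using x by (simp add: nat_pow_pow k flip: nat_pow_mult)
      qed
      then show ?thesis by (rule that)
    qed
  qed
qed

lemma inj_on_power:
  assumes "coprime q (order G)"
  shows "inj_on (\<lambda>x. x [^] q) (carrier G)"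
  by (rule coprime_power_inverse[OF assms]) (rule inj_on_inverseI)

lemma conj_nat_pow:
  assumes "g \<in> carrier G" "x \<in> carrier G"
  shows "(x \<otimes> g \<otimes> inv x) [^] (k :: nat) = x \<otimes> (g [^] k) \<otimes> inv x"
  using conj_int_pow[OF assms, of "int k"] by (simp add: int_pow_int)

lemma conj_class_subset: "g \<in> carrier G \<Longrightarrow> conj_class G g \<subseteq> carrier G"
  by (auto simp: conj_class_eq)

lemma power_in_conj_class_iff:
  assumes "coprime q (order G)" "x \<in> carrier G" "y \<in> carrier G"
  shows "y [^] q \<in> conj_class G (x [^] q) \<longleftrightarrow> y \<in> conj_class G x"
proof
  assume "y [^] q \<in> conj_class G (x [^] q)"
  then obtain h where h: "h \<in> carrier G" "y [^] q = (h \<otimes> x \<otimes> inv h) [^] q"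
    using assms(2) by (auto simp: conj_class_eq conj_nat_pow)
  then have "y = h \<otimes> x \<otimes> inv h"
    using inj_onD[OF inj_on_power[OF assms(1)]] assms by simp
  then show "y \<in> conj_class G x" using h assms by (auto simp: conj_class_eq)
next
  assume "y \<in> conj_class G x"
  then show "y [^] q \<in> conj_class G (x [^] q)"
    using assms by (auto simp: conj_class_eq conj_nat_pow)
qed

lemma card_conj_class_power:
  assumes "coprime q (order G)" "x \<in> carrier G"
  shows "card (conj_class G (x [^] q)) = card (conj_class G x)"
proof -
  have "(\<lambda>y. y [^] q) ` conj_class G x = conj_class G (x [^] q)"
  proof (intro equalityI subsetI)
    fix z assume "z \<in> conj_class G (x [^] q)"
    then obtain h where h: "h \<in> carrier G" "z = h \<otimes> x [^] q \<otimes> inv h"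
      using assms by (auto simp: conj_class_eq)
    then have "z = (h \<otimes> x \<otimes> inv h) [^] q" using assms by (simp add: conj_nat_pow)
    moreover have "h \<otimes> x \<otimes> inv h \<in> conj_class G x"
      using h assms by (auto simp: conj_class_eq)
    ultimately show "z \<in> (\<lambda>y. y [^] q) ` conj_class G x" by blast
  qed (use assms in \<open>auto simp: conj_class_eq conj_nat_pow\<close>)
  moreover have "inj_on (\<lambda>y. y [^] q) (conj_class G x)"
    using inj_on_power[OF assms(1)] conj_class_subset[OF assms(2)] by (rule inj_on_subset)
  ultimately show ?thesis by (metis card_image)
qed

lemma card_conj_class_dvd:
  assumes "x \<in> carrier G"
  shows "card (conj_class G x) dvd order G"
proof -
  interpret conj: group_action G "carrier G" "\<lambda>h. \<lambda>x\<in>carrier G. h \<otimes> x \<otimes> inv h"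
    by (rule action_by_conjugation)
  show ?thesis
    unfolding conj_class_def by (rule dvdI[OF conj.orbit_stabilizer_theorem[OF assms, symmetric]])
qed

definition mprod :: "'a list \<Rightarrow> 'a"
  where "mprod xs = foldr (\<otimes>) xs \<one>"

lemma mprod_simps [simp]: "mprod [] = \<one>" "mprod (x # xs) = x \<otimes> mprod xs"
  by (simp_all add: mprod_def)

lemma mprod_closed: "set xs \<subseteq> carrier G \<Longrightarrow> mprod xs \<in> carrier G"
  by (induction xs) auto

lemma mprod_snoc: "set xs \<subseteq> carrier G \<Longrightarrow> x \<in> carrier G \<Longrightarrow> mprod (xs @ [x]) = mprod xs \<otimes> x"
  by (induction xs) (auto simp: m_assoc mprod_closed)

lemma mprod_replicate: "y \<in> carrier G \<Longrightarrow> mprod (replicate k y) = y [^] k"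
  by (induction k) (auto simp flip: nat_pow_Suc2)

lemma mprod_rotate1:
  assumes "set xs \<subseteq> carrier G" "g \<in> carrier G" "mprod xs \<in> conj_class G g"
  shows "mprod (rotate1 xs) \<in> conj_class G g"
proof (cases xs)
  case Nil
  then show ?thesis using assms by simp
next
  case (Cons x ys)
  obtain h where h: "h \<in> carrier G" "mprod xs = h \<otimes> g \<otimes> inv h"
    using assms by (auto simp: conj_class_eq)
  have c: "x \<in> carrier G" "mprod ys \<in> carrier G" using assms(1) Cons mprod_closed by auto
  have "mprod (rotate1 xs) = mprod ys \<otimes> x" using Cons assms(1) by (simp add: mprod_snoc)
  also have "\<dots> = inv x \<otimes> mprod xs \<otimes> x" using Cons c by (simp add: m_assoc inv_mult_cancel)
  also have "\<dots> = (inv x \<otimes> h) \<otimes> g \<otimes> inv (inv x \<otimes> h)"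
    using h c assms(2) by (simp add: inv_mult_group m_assoc)
  finally show ?thesis using h c assms(2) unfolding conj_class_eq[OF assms(2)] by blast
qed

lemma cpow_eq_sum_lists:
  assumes "finite (carrier G)" "g \<in> carrier G"
  shows "cpow f k g = (\<Sum>xs | length xs = k \<and> set xs \<subseteq> carrier G \<and> mprod xs = g. prod_list (map f xs))"
  using assms(2)
proof (induction k arbitrary: g)
  case 0
  have "{xs. length xs = 0 \<and> set xs \<subseteq> carrier G \<and> mprod xs = g} = (if g = \<one> then {[]} else {})"
    by auto
  then show ?case by (simp add: unit_fun_def)
next
  case (Suc k)
  let ?L = "\<lambda>k g. {xs. length xs = k \<and> set xs \<subseteq> carrier G \<and> mprod xs = g}"
  have fin: "finite (?L k g)" for k g
    by (rule finite_subset[OF _ finite_lists_length_eq[OF assms(1), of k]]) auto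
  have "cpow f (Suc k) g = (\<Sum>x\<in>carrier G. \<Sum>ys\<in>?L k (inv x \<otimes> g). f x * prod_list (map f ys))"
    using Suc by (simp add: conv_def sum_distrib_left)
  also have "\<dots> = (\<Sum>(x, ys)\<in>(SIGMA x:carrier G. ?L k (inv x \<otimes> g)). f x * prod_list (map f ys))"
    using assms(1) fin by (simp add: sum.Sigma)
  also have "\<dots> = (\<Sum>xs\<in>?L (Suc k) g. prod_list (map f xs))"
  proof (rule sum.reindex_bij_witness[where i = "\<lambda>xs. (hd xs, tl xs)" and j = "\<lambda>(x, ys). x # ys"])
    fix xs assume xs: "xs \<in> ?L (Suc k) g"
    then obtain x ys where Cons: "xs = x # ys" by (cases xs) auto
    then have "x \<in> carrier G" "mprod ys \<in> carrier G" using xs mprod_closed by auto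
    then show "(hd xs, tl xs) \<in> (SIGMA x:carrier G. ?L k (inv x \<otimes> g))"
      using xs Cons by (auto simp: inv_mult_cancel)
    show "(case (hd xs, tl xs) of (x, ys) \<Rightarrow> x # ys) = xs" using Cons by simp
  next
    fix p assume p: "p \<in> (SIGMA x:carrier G. ?L k (inv x \<otimes> g))"
    then obtain x ys where e: "p = (x, ys)" "x \<in> carrier G" "ys \<in> ?L k (inv x \<otimes> g)" by auto
    have "x \<otimes> (inv x \<otimes> g) = g" using e Suc.prems by (simp flip: m_assoc)
    then show "(case p of (x, ys) \<Rightarrow> x # ys) \<in> ?L (Suc k) g" using e by auto
    show "(hd (case p of (x, ys) \<Rightarrow> x # ys), tl (case p of (x, ys) \<Rightarrow> x # ys)) = p" using e by simp
    show "prod_list (map f (case p of (x, ys) \<Rightarrow> x # ys)) = (case p of (x, ys) \<Rightarrow> f x * prod_list (map f ys))"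
      using e by simp
  qed
  finally show ?case .
qed

text \<open>The Frobenius endomorphism of the centre of the group ring modulo \<open>q\<close> is transport along the \<open>q\<close>-th power
  map. Summing the \<open>q\<close>-fold convolution power over the class \<open>C\<close> of \<open>x\<^sup>q\<close> gives a sum over \<open>q\<close>-tuples with
  product in \<open>C\<close>. Rotating a tuple conjugates its product, so modulo \<open>q\<close> only the constant tuples \<open>(y, ..., y)\<close>
  remain, and there \<open>y\<^sup>q \<in> C\<close> means that \<open>y\<close> is conjugate to \<open>x\<close>. The class sizes on both sides agree and
  are prime to \<open>q\<close>.\<close>
theorem cpow_prime:
  assumes "finite (carrier G)" "prime q" "coprime q (order G)" "class_fun f" "x \<in> carrier G"
  shows "[cpow f q (x [^] q) = f x] (mod int q)"
proof -
  define C where "C = conj_class G (x [^] q)"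
  define X where "X = {xs. length xs = q \<and> set xs \<subseteq> carrier G \<and> mprod xs \<in> C}"
  have xq: "x [^] q \<in> carrier G" using assms by simp
  have Csub: "C \<subseteq> carrier G" unfolding C_def by (rule conj_class_subset[OF xq])
  have finC: "finite C" using Csub assms(1) by (rule finite_subset)
  have finX: "finite X" unfolding X_def
    by (rule finite_subset[OF _ finite_lists_length_eq[OF assms(1), of q]]) auto
  let ?w = "\<lambda>xs. prod_list (map f xs)"
  have q0: "q > 0" using assms(2) by (simp add: prime_gt_0_nat)

  have "sum ?w X = (\<Sum>c\<in>C. sum ?w {xs \<in> X. mprod xs = c})"
    by (rule sum.group[symmetric]) (use finX finC in \<open>auto simp: X_def\<close>)
  also have "\<dots> = (\<Sum>c\<in>C. cpow f q c)"
  proof (rule sum.cong[OF refl])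
    fix c assume c: "c \<in> C"
    then have "{xs \<in> X. mprod xs = c} = {xs. length xs = q \<and> set xs \<subseteq> carrier G \<and> mprod xs = c}"
      by (auto simp: X_def)
    then show "sum ?w {xs \<in> X. mprod xs = c} = cpow f q c"
      using cpow_eq_sum_lists[OF assms(1), of c] c Csub by auto
  qed
  also have "\<dots> = (\<Sum>c\<in>C. cpow f q (x [^] q))"
    by (rule sum.cong[OF refl])
      (use class_fun_on_class[OF class_fun_cpow[OF assms(4)] xq] in \<open>simp add: C_def\<close>)
  finally have 1: "sum ?w X = int (card C) * cpow f q (x [^] q)" by simp

  have "[sum ?w X = sum ?w {xs \<in> X. rotate1 xs = xs}] (mod int q)"
  proof (rule sum_cong_fixpoints[OF finX assms(2)])
    fix xs assume xs: "xs \<in> X"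
    show "rotate1 xs \<in> X" using xs mprod_rotate1[OF _ xq] by (auto simp: X_def C_def)
    show "(rotate1 ^^ q) xs = xs" using xs rotate_id[of q xs] by (simp add: X_def rotate_def)
    show "?w (rotate1 xs) = ?w xs" by (cases xs) simp_all
  qed
  also have "sum ?w {xs \<in> X. rotate1 xs = xs} = (\<Sum>y\<in>conj_class G x. f y ^ q)"
  proof (rule sum.reindex_bij_witness[where i = "\<lambda>y. replicate q y" and j = hd])
    fix xs assume xs: "xs \<in> {xs \<in> X. rotate1 xs = xs}"
    then have len: "length xs = q" by (simp add: X_def)
    then have "card (set xs) = 1" using rotate1_fixpoint_card[of xs] xs q0 by auto
    then obtain y where "set xs = {y}" by (rule card_1_singletonE)
    then have r: "xs = replicate q y" using len by (metis replicate_eqI singletonD)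
    then have h: "hd xs = y" using q0 by simp
    show "replicate q (hd xs) = xs" using r h by simp
    have y: "y \<in> carrier G" "y [^] q \<in> C" using xs r q0 by (auto simp: X_def mprod_replicate)
    show "hd xs \<in> conj_class G x"
      using power_in_conj_class_iff[OF assms(3,5) y(1)] y(2) h by (simp add: C_def)
    show "f (hd xs) ^ q = ?w xs" unfolding h by (simp add: r prod_list_replicate)
  next
    fix y assume y: "y \<in> conj_class G x"
    then have yG: "y \<in> carrier G" using conj_class_subset[OF assms(5)] by auto
    then show "replicate q y \<in> {xs \<in> X. rotate1 xs = xs}"
      using y power_in_conj_class_iff[OF assms(3,5) yG] by (auto simp: X_def C_def mprod_replicate)
    show "hd (replicate q y) = y" using q0 by simp
  qed
  also have "[(\<Sum>y\<in>conj_class G x. f y ^ q) = (\<Sum>y\<in>conj_class G x. f x)] (mod int q)"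
  proof (rule cong_sum)
    fix y assume "y \<in> conj_class G x"
    then have "f y = f x" using class_fun_on_class[OF assms(4,5)] by simp
    then show "[f y ^ q = f x] (mod int q)" using cong_power_prime[OF assms(2)] by simp
  qed
  finally have "[int (card C) * cpow f q (x [^] q) = int (card C) * f x] (mod int q)"
    unfolding 1 using card_conj_class_power[OF assms(3,5)] by (simp add: C_def)
  moreover have "coprime (int (card C)) (int q)"
    using card_conj_class_dvd[OF xq] assms(3) coprime_divisors[of "card C" "order G" q q]
    by (auto simp: C_def coprime_commute)
  ultimately show ?thesis using cong_mult_lcancel by blast
qed

lemma power_class_fun_cong:
  assumes "coprime q (order G)" "\<And>g. g \<in> carrier G \<Longrightarrow> [f (g [^] q) = h (g [^] q)] (mod int r)"
  shows "fun_cong f h r"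
  unfolding fun_cong_def
proof
  fix g assume g: "g \<in> carrier G"
  obtain b where b: "\<And>x. x \<in> carrier G \<Longrightarrow> (x [^] q) [^] (b :: nat) = x"
    using coprime_power_inverse[OF assms(1)] by blast
  have "(g [^] b) [^] q = g" using b[OF g] g by (simp add: nat_pow_pow mult.commute)
  then show "[f g = h g] (mod int r)" using assms(2)[of "g [^] b"] g by simp
qed

lemma cpow_prime_power:
  assumes "finite (carrier G)" "prime q" "coprime q (order G)" "class_fun f" "x \<in> carrier G"
  shows "[cpow f (q ^ j) (x [^] (q ^ j)) = f x] (mod int q)"
  using assms(5)
proof (induction j arbitrary: x)
  case 0
  then show ?case by (simp add: conv_unit[OF assms(4,1)])
next
  case (Suc j)
  have "cpow f (q ^ Suc j) = cpow (cpow f (q ^ j)) q"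
    using cpow_mult[OF assms(4,1), of "q ^ j" q] by (simp add: mult.commute)
  moreover have "x [^] (q ^ Suc j) = (x [^] (q ^ j)) [^] q"
    using Suc.prems by (simp add: nat_pow_pow mult.commute)
  ultimately have "[cpow f (q ^ Suc j) (x [^] (q ^ Suc j)) = cpow f (q ^ j) (x [^] (q ^ j))] (mod int q)"
    using cpow_prime[OF assms(1-3) class_fun_cpow[OF assms(4)]] Suc.prems by simp
  then show ?case using Suc cong_trans by blast
qed

text \<open>Take \<open>Q = q\<^sup>j\<close> congruent to 1 modulo the group order, so that \<open>x \<mapsto> x\<^sup>Q\<close> is the identity. Consequently the ring
  of class functions modulo \<open>q\<close> is reduced, and \<open>f\<^sup>Q\<^sup>-\<^sup>1\<close> is an idempotent with the same annihilator as \<open>f\<close>.\<close>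
lemma ex_cpow_cong_self:
  assumes "finite (carrier G)" "prime q" "coprime q (order G)" "2 < q"
  obtains Q where "Q \<ge> 3" "odd Q" "\<And>f. class_fun f \<Longrightarrow> fun_cong (cpow f Q) f q"
proof -
  define j where "j = totient (order G)"
  have n0: "order G > 0" using assms(1) by (simp add: order_gt_0_iff_finite)
  have j0: "j > 0" using n0 by (simp add: j_def)
  have 1: "[q ^ j = 1] (mod order G)" unfolding j_def by (rule euler_theorem[OF assms(3)])
  have "1 \<le> q ^ j" using assms(4) by simp
  then obtain k where k: "q ^ j = k * order G + 1" using 1 cong_le_nat by blast
  have fixed: "x [^] (q ^ j) = x" if x: "x \<in> carrier G" for x
  proof -
    have "x [^] (k * order G) = \<one>"
      using x pow_order_eq_1[OF x] by (metis mult.commute nat_pow_one nat_pow_pow)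
    then show ?thesis using x by (simp add: k flip: nat_pow_mult)
  qed
  show ?thesis
  proof (rule that)
    have "q \<le> q ^ j" using j0 assms(4) self_le_power[of q j] by simp
    then show "q ^ j \<ge> 3" using assms(4) by simp
    show "odd (q ^ j)" using prime_odd_nat[OF assms(2,4)] by simp
    show "fun_cong (cpow f (q ^ j)) f q" if "class_fun f" for f
      unfolding fun_cong_def using cpow_prime_power[OF assms(1-3) that, of _ j] fixed by auto
  qed
qed

section \<open>Odd class functions with small annihilator\<close>

lemma parity_add:
  assumes "parity c f" "parity c h"
  shows "parity c (\<lambda>g. f g + h g)"
  using assms by (auto simp: parity_def class_fun_def distrib_left)

lemma parity_diff:
  assumes "parity c f" "parity c h"
  shows "parity c (\<lambda>g. f g - h g)"
  using assms by (auto simp: parity_def class_fun_def right_diff_distrib)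

lemma parity_scale:
  assumes "parity c f"
  shows "parity c (\<lambda>g. a * f g)"
  using assms by (auto simp: parity_def class_fun_def)

lemma conv_zero: "conv f (\<lambda>_. 0) = (\<lambda>_. 0)"
  by (auto simp: conv_def)

lemma fun_cong_zero_conv:
  assumes "fun_cong h (\<lambda>_. 0) q"
  shows "fun_cong (conv f h) (\<lambda>_. 0) q"
  using fun_cong_conv[OF fun_cong_refl assms, of f] by (simp add: conv_zero)

lemma fun_cong_add:
  assumes "fun_cong f f' q" "fun_cong h h' q"
  shows "fun_cong (\<lambda>g. f g + h g) (\<lambda>g. f' g + h' g) q"
  using assms by (auto simp: fun_cong_def intro: cong_add)

lemma fun_cong_diff_zero_iff: "fun_cong (\<lambda>g. f g - h g) (\<lambda>_. 0) q \<longleftrightarrow> fun_cong f h q"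
  by (simp add: fun_cong_def cong_diff_iff_cong_0)

text \<open>Modulo \<open>q\<close>, some odd \<open>\<theta>\<close> divides every odd function. Choose \<open>\<theta>\<close> with the smallest annihilator, and let \<open>e\<close> be
  the idempotent \<open>\<theta>\<^sup>Q\<^sup>-\<^sup>1\<close>. For an odd \<open>\<psi>\<close> the function \<open>\<phi> = \<psi> - \<psi> e\<close> is orthogonal to \<open>\<theta>\<close>. If it were nonzero,
  then \<open>\<theta> + \<phi>\<close> would have a smaller annihilator: multiplication by \<open>e\<close> recovers \<open>\<theta>\<close> from it, while \<open>\<phi>\<close>
  annihilates \<open>\<theta>\<close> but not \<open>\<theta> + \<phi>\<close>, because \<open>\<phi>\<^sup>2\<close> is nonzero in a reduced ring. Hence
  \<open>\<psi> = \<psi> e = \<theta> (\<theta>\<^sup>Q\<^sup>-\<^sup>2 \<psi>)\<close>.\<close>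
lemma ex_generic_odd_fun:
  assumes "finite (carrier G)" "prime q" "coprime q (order G)" "2 < q"
  obtains \<theta> where "parity (- 1) \<theta>"
    "\<And>\<psi>. parity (- 1) \<psi> \<Longrightarrow> \<exists>\<chi>. parity (- 1) \<chi> \<and> fun_cong (conv \<theta> (conv \<chi> \<psi>)) \<psi> q"
proof -
  obtain Q where Q: "Q \<ge> 3" "odd Q" "\<And>f. class_fun f \<Longrightarrow> fun_cong (cpow f Q) f q"
    using ex_cpow_cong_self[OF assms] by blast
  \<comment> \<open>Reduced representatives modulo \<open>q\<close>: annihilators counted inside \<open>R\<close> are finite.\<close>
  define R where "R = {z. class_fun z \<and> (\<forall>g. 0 \<le> z g \<and> z g < int q)}"
  define Ann where "Ann = (\<lambda>\<theta>. {z \<in> R. fun_cong (conv z \<theta>) (\<lambda>_. 0) q})"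
  have "R \<subseteq> {z. \<forall>g. (g \<in> carrier G \<longrightarrow> z g \<in> {0..<int q}) \<and> (g \<notin> carrier G \<longrightarrow> z g = 0)}"
    by (auto simp: R_def class_fun_def)
  moreover have "finite {z. \<forall>g. (g \<in> carrier G \<longrightarrow> z g \<in> {0..<int q}) \<and> (g \<notin> carrier G \<longrightarrow> z g = 0)}"
    by (rule finite_set_of_finite_funs[OF assms(1)]) simp
  ultimately have finR: "finite R" by (rule finite_subset)
  then have finAnn: "finite (Ann \<theta>)" for \<theta> by (simp add: Ann_def)
  have "parity (- 1) (\<lambda>_. 0)" by (simp add: parity_def class_fun_def)
  then obtain \<theta> where \<theta>: "parity (- 1) \<theta>"
    and min: "\<And>\<theta>'. parity (- 1) \<theta>' \<Longrightarrow> card (Ann \<theta>) \<le> card (Ann \<theta>')"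
    using ex_has_least_nat[of "parity (- 1)" _ "\<lambda>\<theta>. card (Ann \<theta>)"] by blast
  define P where "P = cpow \<theta> (Q - 2)"
  define e where "e = conv \<theta> P"
  have Q2: "Q = Suc (Suc (Q - 2))" using Q(1) by simp
  have "odd (Q - 2)" using Q(1,2) by simp
  then have P: "parity (- 1) P" using parity_cpow[OF \<theta>, of "Q - 2"] by (simp add: P_def)
  have e: "parity 1 e" using parity_conv[OF \<theta> P] by (simp add: e_def)
  note cf = parity_class_fun[OF \<theta>] parity_class_fun[OF P] parity_class_fun[OF e]
  have "conv e \<theta> = cpow \<theta> Q"
    unfolding e_def conv_comm[OF cf(1)] P_def by (subst (2) Q2) simp
  then have e\<theta>: "fun_cong (conv e \<theta>) \<theta> q" using Q(3)[OF cf(1)] by simp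
  show ?thesis
  proof (rule that[OF \<theta>])
    fix \<psi> assume \<psi>: "parity (- 1) \<psi>"
    note cf\<psi> = parity_class_fun[OF \<psi>]
    define \<phi> where "\<phi> = (\<lambda>g. \<psi> g - conv \<psi> e g)"
    have \<phi>: "parity (- 1) \<phi>"
      unfolding \<phi>_def using parity_conv[OF \<psi> e] \<psi> by (intro parity_diff) simp_all
    note cf\<phi> = parity_class_fun[OF \<phi>]
    have "fun_cong (conv \<psi> \<theta>) (conv \<psi> (conv e \<theta>)) q"
      by (intro fun_cong_conv fun_cong_refl fun_cong_sym[OF e\<theta>])
    moreover have "conv \<theta> \<phi> = (\<lambda>g. conv \<psi> \<theta> g - conv \<psi> (conv e \<theta>) g)"
      unfolding \<phi>_def conv_diff conv_left_comm[OF cf(1) cf\<psi>] conv_comm[OF cf\<psi>, of \<theta>] conv_comm[OF cf(3), of \<theta>] ..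
    ultimately have \<theta>\<phi>: "fun_cong (conv \<theta> \<phi>) (\<lambda>_. 0) q"
      by (simp add: fun_cong_diff_zero_iff)
    have "conv e \<phi> = conv P (conv \<theta> \<phi>)"
      unfolding e_def conv_assoc by (rule conv_left_comm[OF cf(1,2)])
    then have e\<phi>: "fun_cong (conv e \<phi>) (\<lambda>_. 0) q"
      using fun_cong_zero_conv[OF \<theta>\<phi>] by simp
    have "fun_cong \<phi> (\<lambda>_. 0) q"
    proof (rule ccontr)
      assume n0: "\<not> fun_cong \<phi> (\<lambda>_. 0) q"
      define \<theta>' where "\<theta>' = (\<lambda>g. \<theta> g + \<phi> g)"
      have \<theta>': "parity (- 1) \<theta>'" unfolding \<theta>'_def by (rule parity_add[OF \<theta> \<phi>])
      have "fun_cong (\<lambda>g. conv e \<theta> g + conv e \<phi> g) (\<lambda>g. \<theta> g + 0) q"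
        by (rule fun_cong_add[OF e\<theta> e\<phi>])
      then have e\<theta>': "fun_cong (conv e \<theta>') \<theta> q" by (simp add: \<theta>'_def conv_add)
      have "Ann \<theta>' \<subseteq> Ann \<theta>"
      proof
        fix z assume "z \<in> Ann \<theta>'"
        then have z: "z \<in> R" "fun_cong (conv z \<theta>') (\<lambda>_. 0) q" by (auto simp: Ann_def)
        then have cz: "class_fun z" by (simp add: R_def)
        have "fun_cong (conv z \<theta>) (conv z (conv e \<theta>')) q"
          by (intro fun_cong_conv fun_cong_refl fun_cong_sym[OF e\<theta>'])
        also have "conv z (conv e \<theta>') = conv e (conv z \<theta>')"
          by (rule conv_left_comm[OF cz cf(3)])
        also have "fun_cong (conv e (conv z \<theta>')) (\<lambda>_. 0) q"
          by (rule fun_cong_zero_conv[OF z(2)])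
        finally show "z \<in> Ann \<theta>" using z(1) by (simp add: Ann_def)
      qed
      moreover have "Ann \<theta>' \<noteq> Ann \<theta>"
      proof
        assume eq: "Ann \<theta>' = Ann \<theta>"
        define z where "z = (\<lambda>g. \<phi> g mod int q)"
        have zR: "z \<in> R" using cf\<phi> assms(4) by (auto simp: z_def R_def class_fun_def)
        have z\<phi>: "fun_cong z \<phi> q" by (simp add: z_def fun_cong_def cong_def)
        have "fun_cong (conv z \<theta>) (conv \<phi> \<theta>) q" by (intro fun_cong_conv fun_cong_refl z\<phi>)
        also have "conv \<phi> \<theta> = conv \<theta> \<phi>" by (rule conv_comm[OF cf(1)])
        also note \<theta>\<phi>
        finally have "z \<in> Ann \<theta>" using zR by (simp add: Ann_def)
        then have "z \<in> Ann \<theta>'" using eq by simp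
        then have "fun_cong (conv z \<theta>') (\<lambda>_. 0) q" by (simp add: Ann_def)
        then have 1: "fun_cong (conv \<phi> \<theta>') (\<lambda>_. 0) q"
          using fun_cong_trans[OF fun_cong_conv[OF fun_cong_sym[OF z\<phi>] fun_cong_refl]] by blast
        have "fun_cong (\<lambda>g. 0 + conv \<phi> \<phi> g) (\<lambda>g. conv \<phi> \<theta> g + conv \<phi> \<phi> g) q"
          by (intro fun_cong_add fun_cong_refl fun_cong_sym[OF \<theta>\<phi>[unfolded conv_comm[OF cf\<phi>, of \<theta>]]])
        then have "fun_cong (conv \<phi> \<phi>) (conv \<phi> \<theta>') q"
          by (simp add: \<theta>'_def conv_add)
        then have 2: "fun_cong (conv \<phi> \<phi>) (\<lambda>_. 0) q" using 1 by (rule fun_cong_trans)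
        have "cpow \<phi> Q = conv (cpow \<phi> (Q - 2)) (conv \<phi> \<phi>)"
          unfolding conv_comm[OF class_fun_conv[OF cf\<phi> cf\<phi>], of "cpow \<phi> (Q - 2)"] conv_assoc
          by (subst Q2) simp
        then have "fun_cong (cpow \<phi> Q) (\<lambda>_. 0) q" using fun_cong_zero_conv[OF 2] by simp
        then have "fun_cong \<phi> (\<lambda>_. 0) q" using fun_cong_trans[OF fun_cong_sym[OF Q(3)[OF cf\<phi>]]] by blast
        then show False using n0 by contradiction
      qed
      ultimately have "card (Ann \<theta>') < card (Ann \<theta>)"
        using finAnn by (intro psubset_card_mono) auto
      then show False using min[OF \<theta>'] by simp
    qed
    then have "fun_cong \<psi> (conv \<psi> e) q" unfolding \<phi>_def fun_cong_diff_zero_iff .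
    moreover have "conv \<psi> e = conv \<theta> (conv P \<psi>)"
      unfolding e_def conv_left_comm[OF cf\<psi> cf(1)] conv_comm[OF cf\<psi>, of P] ..
    ultimately have "fun_cong (conv \<theta> (conv P \<psi>)) \<psi> q" using fun_cong_sym by simp
    then show "\<exists>\<chi>. parity (- 1) \<chi> \<and> fun_cong (conv \<theta> (conv \<chi> \<psi>)) \<psi> q"
      using P by blast
  qed
qed

end

section \<open>Conjugacy classes in a group of odd order\<close>

context group
begin

lemma conj_class_sym:
  assumes "x \<in> carrier G" "y \<in> conj_class G x"
  shows "conj_class G y = conj_class G x"
  using assms by (auto simp: conj_class_eq[of x] conj_class_conj)

lemma conj_class_eq_iff:
  assumes "x \<in> carrier G" "y \<in> carrier G"
  shows "conj_class G x = conj_class G y \<longleftrightarrow> x \<in> conj_class G y"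
  using conj_class_sym[OF assms(2)] conj_class_self[OF assms(1)] by blast

lemma conj_class_inv:
  assumes "x \<in> carrier G" "y \<in> conj_class G x"
  shows "inv y \<in> conj_class G (inv x)"
proof -
  obtain h where h: "h \<in> carrier G" "y = h \<otimes> x \<otimes> inv h"
    using assms by (auto simp: conj_class_eq)
  then have "inv y = h \<otimes> inv x \<otimes> inv h"
    using assms(1) by (simp add: inv_mult_group m_assoc)
  then show ?thesis using h(1) assms(1) by (auto simp: conj_class_eq)
qed

lemma conj_in_conj_class_iff:
  assumes "y \<in> carrier G" "g \<in> carrier G" "x \<in> carrier G"
  shows "x \<otimes> g \<otimes> inv x \<in> conj_class G y \<longleftrightarrow> g \<in> conj_class G y"
proof -
  have "g \<in> conj_class G y \<longleftrightarrow> conj_class G g = conj_class G y" if "g \<in> carrier G" for g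
    using conj_class_sym[OF assms(1)] conj_class_self[OF that] by blast
  then show ?thesis using conj_class_conj[OF assms(2,3)] assms by simp
qed

lemma inv_in_conj_class_iff:
  assumes "y \<in> carrier G" "g \<in> carrier G"
  shows "inv g \<in> conj_class G y \<longleftrightarrow> g \<in> conj_class G (inv y)"
  using conj_class_inv[of y "inv g"] conj_class_inv[of "inv y" g] assms by auto

definition class_inv :: "'a set \<Rightarrow> 'a set"
  where "class_inv C = m_inv G ` C"

lemma class_inv_conj_class:
  assumes "g \<in> carrier G"
  shows "class_inv (conj_class G g) = conj_class G (inv g)"
proof (intro equalityI subsetI)
  fix x assume x: "x \<in> conj_class G (inv g)"
  then have "x \<in> carrier G" using conj_class_subset[of "inv g"] assms by auto
  moreover have "inv x \<in> conj_class G g" using conj_class_inv[of "inv g" x] x assms by simp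
  ultimately show "x \<in> class_inv (conj_class G g)"
    unfolding class_inv_def by (intro image_eqI[of _ _ "inv x"]) simp_all
qed (use assms conj_class_inv in \<open>auto simp: class_inv_def\<close>)

text \<open>The pair formed by a class and the inverse class, as a set of group elements. Even class functions are
  the functions constant on blocks.\<close>
definition block :: "'a \<Rightarrow> 'a set"
  where "block g = conj_class G g \<union> conj_class G (inv g)"

lemma block_subset: "g \<in> carrier G \<Longrightarrow> block g \<subseteq> carrier G"
  using conj_class_subset by (simp add: block_def)

lemma block_self: "g \<in> carrier G \<Longrightarrow> g \<in> block g"
  by (simp add: block_def conj_class_self)

lemma block_eq:
  assumes "g \<in> carrier G" "x \<in> block g"
  shows "block x = block g"
proof -
  have *: "conj_class G x = conj_class G y \<and> conj_class G (inv x) = conj_class G (inv y)"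
    if "x \<in> conj_class G y" "y \<in> carrier G" for y
    using conj_class_sym[OF that(2,1)] conj_class_sym[OF _ conj_class_inv[OF that(2,1)]] that(2) by simp
  from assms(2) consider "x \<in> conj_class G g" | "x \<in> conj_class G (inv g)"
    by (auto simp: block_def)
  then show ?thesis
  proof cases
    case 1
    then show ?thesis using *[of g] assms(1) by (simp add: block_def)
  next
    case 2
    then show ?thesis using *[of "inv g"] assms(1) by (simp add: block_def Un_commute)
  qed
qed

lemma block_one: "block \<one> = {\<one>}"
  using conj_class_self[of \<one>] by (auto simp: block_def conj_class_eq)

lemma inv_in_block: "g \<in> carrier G \<Longrightarrow> x \<in> block g \<Longrightarrow> inv x \<in> block g"
  using conj_class_inv[of g x] conj_class_inv[of "inv g" x] by (auto simp: block_def)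

lemma conj_in_block:
  assumes "g \<in> carrier G" "x \<in> carrier G" "h \<in> carrier G"
  shows "h \<otimes> x \<otimes> inv h \<in> block g \<longleftrightarrow> x \<in> block g"
proof -
  have *: "h \<otimes> x \<otimes> inv h \<in> block g" if "x \<in> block g" "x \<in> carrier G" "h \<in> carrier G" for x h
  proof -
    have "h \<otimes> x \<otimes> inv h \<in> conj_class G x" using that by (auto simp: conj_class_eq)
    then show ?thesis using block_eq[OF assms(1) that(1)] by (auto simp: block_def)
  qed
  have "inv h \<otimes> (h \<otimes> x \<otimes> inv h) \<otimes> inv (inv h) = x"
    using assms by (simp add: m_assoc inv_mult_cancel)
  then show ?thesis using *[of x h] *[of "h \<otimes> x \<otimes> inv h" "inv h"] assms by auto
qed

lemma even_fun_on_block: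
  assumes "parity 1 f" "g \<in> carrier G" "x \<in> block g"
  shows "f x = f g"
  using assms(3) class_fun_on_class[OF parity_class_fun[OF assms(1)], of g x]
    class_fun_on_class[OF parity_class_fun[OF assms(1)], of "inv g" x] assms(1,2)
  by (auto simp: block_def parity_def)

lemma power_in_block_iff:
  assumes "coprime q (order G)" "x \<in> carrier G" "y \<in> carrier G"
  shows "y [^] q \<in> block (x [^] q) \<longleftrightarrow> y \<in> block x"
  using power_in_conj_class_iff[OF assms] power_in_conj_class_iff[of q "inv x" y] assms
  by (simp add: block_def nat_pow_inv)

end

locale odd_group = group +
  assumes fin: "finite (carrier G)" and odd_order: "odd (order G)"
begin

lemma coprime_2_order: "coprime 2 (order G)"
  using odd_order by simp

text \<open>If conjugation by \<open>h\<close> inverts \<open>x\<close>, then so does conjugation by every odd power of \<open>h\<close>, among them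
  \<open>h\<^sup>n = 1\<close> for the group order \<open>n\<close>; thus \<open>x\<^sup>2 = 1\<close>, and \<open>x\<close> has odd order.\<close>
lemma real_element_trivial:
  assumes "x \<in> carrier G" "inv x \<in> conj_class G x"
  shows "x = \<one>"
proof -
  obtain h where h: "h \<in> carrier G" "h \<otimes> x \<otimes> inv h = inv x"
    using assms by (auto simp: conj_class_eq)
  have "h [^] k \<otimes> x \<otimes> inv (h [^] k) = (if even k then x else inv x)" for k :: nat
  proof (induction k)
    case 0
    then show ?case using assms by simp
  next
    case (Suc k)
    have "h [^] Suc k \<otimes> x \<otimes> inv (h [^] Suc k) = h \<otimes> (h [^] k \<otimes> x \<otimes> inv (h [^] k)) \<otimes> inv h"
      using h(1) assms(1) by (simp only: nat_pow_Suc2 inv_mult_group nat_pow_closed m_assoc m_closed inv_closed)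
    moreover have "h \<otimes> inv x \<otimes> inv h = inv (h \<otimes> x \<otimes> inv h)"
      using h(1) assms(1) by (simp add: inv_mult_group m_assoc)
    ultimately show ?case using Suc h assms(1) by simp
  qed
  from this[of "order G"] have "x = inv x"
    using odd_order assms(1) pow_order_eq_1[OF h(1)] by simp
  then have "x [^] (2 :: nat) = \<one>"
    using assms(1) by (metis numeral_2_eq_2 nat_pow_Suc nat_pow_0 l_one r_inv)
  then show ?thesis
    using inj_onD[OF inj_on_power[OF coprime_2_order], of x \<one>] assms(1) by simp
qed

lemma ex_block_representatives:
  obtains K :: nat and rep :: "nat \<Rightarrow> 'a" where "0 < K" "rep 0 = \<one>"
    "\<And>i. i < K \<Longrightarrow> rep i \<in> carrier G" "\<And>x. x \<in> carrier G \<Longrightarrow> \<exists>i<K. x \<in> block (rep i)"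
    "\<And>i j x. i < K \<Longrightarrow> j < K \<Longrightarrow> x \<in> block (rep i) \<Longrightarrow> x \<in> block (rep j) \<Longrightarrow> i = j"
proof -
  define S where "S = block ` (carrier G - {\<one>})"
  have "finite S" using fin by (simp add: S_def)
  then obtain h where h: "bij_betw h {0..<card S} S" using ex_bij_betw_nat_finite by blast
  define r where "r = (\<lambda>B. SOME x. x \<in> carrier G - {\<one>} \<and> block x = B)"
  have r: "r B \<in> carrier G - {\<one>} \<and> block (r B) = B" if "B \<in> S" for B
    unfolding r_def by (rule someI_ex) (use that in \<open>auto simp: S_def\<close>)
  define rep where "rep = (\<lambda>i. if i = 0 then \<one> else r (h (i - 1)))"
  have hS: "h (i - 1) \<in> S" if "i < Suc (card S)" "0 < i" for i
    by (rule bij_betwE[OF h, rule_format]) (use that in auto)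
  show ?thesis
  proof (rule that[of "Suc (card S)" rep])
    show repc: "rep i \<in> carrier G" if "i < Suc (card S)" for i
      using r[OF hS[OF that]] by (auto simp: rep_def)
    show "\<exists>i<Suc (card S). x \<in> block (rep i)" if x: "x \<in> carrier G" for x
    proof (cases "x = \<one>")
      case True
      then show ?thesis by (intro exI[of _ 0]) (simp add: rep_def block_one)
    next
      case False
      then have "block x \<in> S" using x by (simp add: S_def)
      then have "block x \<in> h ` {0..<card S}" using h by (simp add: bij_betw_def)
      then obtain j where j: "j < card S" "h j = block x" by auto
      then have "block (rep (Suc j)) = block x" using r[OF \<open>block x \<in> S\<close>] by (simp add: rep_def)
      then show ?thesis using j block_self[OF x] by (intro exI[of _ "Suc j"]) simp
    qed
    show "i = j" if ij: "i < Suc (card S)" "j < Suc (card S)" "x \<in> block (rep i)" "x \<in> block (rep j)" for i j x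
    proof -
      have eq: "block (rep i) = block (rep j)"
        using block_eq[OF repc[OF ij(1)] ij(3)] block_eq[OF repc[OF ij(2)] ij(4)] by simp
      have ne: "block (rep k) \<noteq> {\<one>}" if k: "k < Suc (card S)" "k > 0" for k
        using r[OF hS[OF k]] block_self[OF repc[OF k(1)]] k by (auto simp: rep_def)
      have hk: "block (rep k) = h (k - 1)" if k: "k < Suc (card S)" "k > 0" for k
        using r[OF hS[OF k]] k by (simp add: rep_def)
      have z: "block (rep 0) = {\<one>}" by (simp add: rep_def block_one)
      consider "i = 0" "j = 0" | "i = 0" "0 < j" | "0 < i" "j = 0" | "0 < i" "0 < j" by blast
      then show ?thesis
      proof cases
        case 2
        then show ?thesis using ne[OF ij(2)] eq z by metis
      next
        case 3
        then show ?thesis using ne[OF ij(1)] eq z by metis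
      next
        case 4
        then have "h (i - 1) = h (j - 1)" using eq hk ij by metis
        moreover have "i - 1 \<in> {0..<card S}" "j - 1 \<in> {0..<card S}" using 4 ij by auto
        ultimately have "i - 1 = j - 1" using bij_betw_imp_inj_on[OF h] by (metis inj_onD)
        then show ?thesis using 4 by simp
      qed simp
    qed
  qed (simp_all add: rep_def)
qed

end

section \<open>Multiplication matrices and their determinants\<close>

text \<open>Blocks are numbered so that their functions can serve as indices of matrices. The trivial class is
  block 0; the blocks \<open>1, ..., K - 1\<close> are the pairs of distinct mutually inverse classes.\<close>
locale block_reps = odd_group +
  fixes K :: nat and rep :: "nat \<Rightarrow> 'a"
  assumes K_pos: "0 < K" and rep_0: "rep 0 = \<one>"
    and rep_closed: "\<And>i. i < K \<Longrightarrow> rep i \<in> carrier G"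
    and ex_rep: "\<And>x. x \<in> carrier G \<Longrightarrow> \<exists>i<K. x \<in> block (rep i)"
    and rep_unique: "\<And>i j x. i < K \<Longrightarrow> j < K \<Longrightarrow> x \<in> block (rep i) \<Longrightarrow> x \<in> block (rep j) \<Longrightarrow> i = j"
begin

definition block_fun :: "nat \<Rightarrow> 'a \<Rightarrow> int"
  where "block_fun a g = of_bool (g \<in> block (rep a))"

lemma parity_block_fun:
  assumes "a < K"
  shows "parity 1 (block_fun a)"
proof -
  have "inv g \<in> block (rep a) \<longleftrightarrow> g \<in> block (rep a)" if "g \<in> carrier G" for g
    using inv_in_block[OF rep_closed[OF assms], of g] inv_in_block[OF rep_closed[OF assms], of "inv g"] that
    by auto
  then show ?thesis
    using block_subset[OF rep_closed[OF assms]] conj_in_block[OF rep_closed[OF assms]]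
    by (auto simp: parity_def class_fun_def block_fun_def)
qed

lemmas class_fun_block_fun = parity_class_fun[OF parity_block_fun]

lemma block_fun_rep: "i < K \<Longrightarrow> j < K \<Longrightarrow> block_fun j (rep i) = of_bool (i = j)"
  using rep_unique[of i j "rep i"] block_self[OF rep_closed] by (auto simp: block_fun_def)

lemma even_fun_expand:
  assumes "parity 1 z"
  shows "z = (\<lambda>g. \<Sum>a<K. z (rep a) * block_fun a g)"
proof
  fix g
  show "z g = (\<Sum>a<K. z (rep a) * block_fun a g)"
  proof (cases "g \<in> carrier G")
    case True
    then obtain b where b: "b < K" "g \<in> block (rep b)" using ex_rep by blast
    have "(\<Sum>a<K. z (rep a) * block_fun a g) = (\<Sum>a<K. if a = b then z (rep a) else 0)"
    proof (rule sum.cong[OF refl])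
      fix a assume "a \<in> {..<K}"
      then have "g \<in> block (rep a) \<longleftrightarrow> a = b" using rep_unique[of a b g] b by blast
      then show "z (rep a) * block_fun a g = (if a = b then z (rep a) else 0)" by (simp add: block_fun_def)
    qed
    also have "\<dots> = z (rep b)" using b by simp
    also have "\<dots> = z g" using even_fun_on_block[OF assms rep_closed[OF b(1)] b(2)] by simp
    finally show ?thesis by simp
  next
    case False
    then have "block_fun a g = 0" if "a < K" for a
      using block_subset[OF rep_closed[OF that]] by (auto simp: block_fun_def)
    moreover have "z g = 0" using False assms by (simp add: parity_def class_fun_def)
    ultimately show ?thesis by simp
  qed
qed

lemma conv_even_expand:
  assumes "parity 1 z"
  shows "conv x z g = (\<Sum>a<K. z (rep a) * conv x (block_fun a) g)"
  by (subst even_fun_expand[OF assms]) (rule conv_sum)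

definition weight :: "nat \<Rightarrow> int"
  where "weight a = int (card (block (rep a)))"

lemma aug_block_fun: "a < K \<Longrightarrow> aug (block_fun a) = weight a"
  using block_subset[OF rep_closed] fin
  by (simp add: aug_def block_fun_def weight_def Int_absorb1 flip: sum.inter_filter)

lemma weight_0: "weight 0 = 1"
  by (simp add: weight_def rep_0 block_one)

lemma weight_pos: "a < K \<Longrightarrow> weight a > 0"
  using block_self[OF rep_closed] finite_subset[OF block_subset[OF rep_closed] fin]
  by (fastforce simp: weight_def card_gt_0_iff)

lemma aug_even:
  assumes "parity 1 z"
  shows "aug z = (\<Sum>a<K. z (rep a) * aug (block_fun a))"
proof -
  have "aug z = (\<Sum>g\<in>carrier G. \<Sum>a<K. z (rep a) * block_fun a g)"
    unfolding aug_def by (subst even_fun_expand[OF assms]) rule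
  then show ?thesis by (subst (asm) sum.swap) (simp add: aug_def sum_distrib_left)
qed

text \<open>The matrix of multiplication by \<open>x\<close> on the even functions, in the basis of the indicator functions of
  blocks: the coordinates of an even function are its values at the representatives.\<close>
definition mult_matrix :: "('a \<Rightarrow> int) \<Rightarrow> int mat"
  where "mult_matrix x = mat K K (\<lambda>(i, j). conv x (block_fun j) (rep i))"

text \<open>For odd \<open>x\<close>, the matrix of \<open>z \<mapsto> x z + N z\<close> from the even functions to the sum of the odd functions and
  the multiples of the norm element \<open>N\<close>. Both sides have rank \<open>K\<close>. Row 0 is the coefficient of \<open>N\<close>; row
  \<open>i > 0\<close> is the value of the odd part at the representative of block \<open>i\<close>.\<close>
definition odd_matrix :: "('a \<Rightarrow> int) \<Rightarrow> int mat"
  where "odd_matrix x = mat K K (\<lambda>(i, j). if i = 0 then aug (block_fun j) else conv x (block_fun j) (rep i))"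

lemma mult_matrix_carrier [simp]: "mult_matrix x \<in> carrier_mat K K"
  by (simp add: mult_matrix_def)

lemma odd_matrix_carrier [simp]: "odd_matrix x \<in> carrier_mat K K"
  by (simp add: odd_matrix_def)

lemma dim_odd_matrix [simp]: "dim_row (odd_matrix x) = K" "dim_col (odd_matrix x) = K"
  by (simp_all add: odd_matrix_def)

lemma odd_matrix_mult_even:
  assumes "\<And>j. j < K \<Longrightarrow> parity 1 (z j)" "i < K" "j < K"
  shows "(odd_matrix x * mat K K (\<lambda>(i, j). z j (rep i))) $$ (i, j)
    = (if i = 0 then aug (z j) else conv x (z j) (rep i))"
  using assms aug_even[OF assms(1)[OF assms(3)]] conv_even_expand[OF assms(1)[OF assms(3)], of x "rep i"]
  by (simp add: odd_matrix_def scalar_prod_def atLeast0LessThan mult.commute)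

lemma mult_matrix_conv:
  assumes "parity 1 y"
  shows "mult_matrix (conv x y) = mult_matrix x * mult_matrix y"
proof (rule eq_matI)
  fix i j assume "i < dim_row (mult_matrix x * mult_matrix y)" "j < dim_col (mult_matrix x * mult_matrix y)"
  then have ij: "i < K" "j < K" by (simp_all add: mult_matrix_def)
  have "parity 1 (conv y (block_fun j))" using parity_conv[OF assms parity_block_fun[OF ij(2)]] by simp
  from conv_even_expand[OF this, of x "rep i"]
  show "mult_matrix (conv x y) $$ (i, j) = (mult_matrix x * mult_matrix y) $$ (i, j)"
    using ij by (simp add: mult_matrix_def scalar_prod_def atLeast0LessThan conv_assoc mult.commute)
qed (simp_all add: mult_matrix_def)

lemma mult_matrix_unit: "mult_matrix unit_fun = 1\<^sub>m K"
  by (rule eq_matI) (auto simp: mult_matrix_def conv_unit[OF class_fun_block_fun fin] block_fun_rep)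

lemma det_mult_matrix_cpow:
  assumes "parity 1 y"
  shows "det (mult_matrix (cpow y r)) = det (mult_matrix y) ^ r"
proof (induction r)
  case 0
  then show ?case by (simp add: mult_matrix_unit)
next
  case (Suc r)
  have "parity 1 (cpow y r)" using parity_cpow[OF assms] by simp
  then show ?case using Suc by (simp add: mult_matrix_conv det_mult[of _ K])
qed

text \<open>The square of \<open>\<theta> + N\<close>, since \<open>\<theta> N = 0\<close> and \<open>N\<^sup>2 = n N\<close> for \<open>n\<close> the group order.\<close>
definition quad :: "('a \<Rightarrow> int) \<Rightarrow> 'a \<Rightarrow> int"
  where "quad \<theta> = (\<lambda>g. conv \<theta> \<theta> g + int (order G) * norm_fun g)"

lemma parity_quad:
  assumes "parity (- 1) \<theta>"
  shows "parity 1 (quad \<theta>)"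
  unfolding quad_def using parity_conv[OF assms assms] by (intro parity_add parity_scale parity_norm) simp

lemma conv_quad:
  assumes "parity (- 1) \<theta>" "class_fun f"
  shows "conv f (quad \<theta>) = (\<lambda>g. conv f (conv \<theta> \<theta>) g + int (order G) * aug f * norm_fun g)"
  by (simp add: quad_def conv_add conv_scale conv_norm mult.assoc)

text \<open>The summand \<open>n N\<close> of \<open>quad \<theta>\<close> is annihilated by \<open>\<theta>\<close>.\<close>
lemma odd_conv_cpow_quad:
  assumes "parity (- 1) \<theta>"
  shows "conv \<theta> (cpow (quad \<theta>) r) = cpow \<theta> (2 * r + 1)"
proof (induction r)
  case 0
  then show ?case by simp
next
  case (Suc r)
  have "conv \<theta> (quad \<theta>) = conv \<theta> (conv \<theta> \<theta>)"
    using conv_quad[OF assms parity_class_fun[OF assms]] aug_odd[OF assms] by simp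
  then have "conv \<theta> (cpow (quad \<theta>) (Suc r)) = conv (conv \<theta> (conv \<theta> \<theta>)) (cpow (quad \<theta>) r)"
    by (simp flip: conv_assoc)
  also have "\<dots> = conv \<theta> (conv \<theta> (conv \<theta> (cpow (quad \<theta>) r)))" by (simp add: conv_assoc)
  finally show ?case by (simp add: Suc)
qed

lemma aug_quad:
  assumes "parity (- 1) \<theta>"
  shows "aug (quad \<theta>) = int (order G) ^ 2"
proof -
  have "aug (quad \<theta>) = aug (conv \<theta> \<theta>) + int (order G) * aug norm_fun"
    by (simp add: quad_def aug_def sum.distrib sum_distrib_left)
  then show ?thesis by (simp add: aug_conv aug_odd[OF assms] aug_norm power2_eq_square)
qed

text \<open>Both sides are the value at 1 of the product of \<open>quad \<theta>\<close> with the indicator functions of blocks \<open>i\<close> and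
  \<open>j\<close>. On the left it is split as \<open>(\<theta> b\<^sub>i) (\<theta> b\<^sub>j)\<close> plus a multiple of the norm element. The form \<open>(x y)(1)\<close> is
  diagonal in either basis: on even functions its entries are the block sizes, on odd functions their
  negatives, because \<open>y (inv x) = - y x\<close>, and on the norm element it is the group order.\<close>
lemma gram_identity:
  assumes \<theta>: "parity (- 1) \<theta>" and ij: "i < K" "j < K"
  shows "(\<Sum>a<K. odd_matrix \<theta> $$ (a, i) * ((if a = 0 then int (order G) else - weight a) * odd_matrix \<theta> $$ (a, j)))
    = weight i * mult_matrix (quad \<theta>) $$ (i, j)"
proof -
  note cf = parity_class_fun[OF \<theta>]
  define u where "u = conv \<theta> (block_fun i)"
  define v where "v = conv \<theta> (block_fun j)"
  define n where "n = int (order G)"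
  have u: "parity (- 1) u" and v: "parity (- 1) v"
    using parity_conv[OF \<theta> parity_block_fun] ij by (simp_all add: u_def v_def)
  have one0: "u \<one> = 0" 
  proof -
    have "u (inv \<one>) = - 1 * u \<one>" using u one_closed unfolding parity_def by blast
    then show ?thesis by simp
  qed
  have ev: "parity 1 (\<lambda>g. u g * v g)"
    using u v by (simp add: parity_def class_fun_def)
  have "conv (block_fun i) (conv (quad \<theta>) (block_fun j)) \<one> = weight i * mult_matrix (quad \<theta>) $$ (i, j)"
  proof -
    have p: "parity 1 (conv (quad \<theta>) (block_fun j))"
      using parity_conv[OF parity_quad[OF \<theta>] parity_block_fun[OF ij(2)]] by simp
    have "conv (block_fun i) (conv (quad \<theta>) (block_fun j)) \<one> = (\<Sum>g\<in>carrier G. block_fun i g * conv (quad \<theta>) (block_fun j) g)"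
      using p by (simp add: conv_at_one parity_def)
    also have "\<dots> = (\<Sum>g\<in>carrier G. block_fun i g * conv (quad \<theta>) (block_fun j) (rep i))"
      using even_fun_on_block[OF p rep_closed[OF ij(1)]] by (intro sum.cong refl) (simp add: block_fun_def)
    also have "\<dots> = weight i * mult_matrix (quad \<theta>) $$ (i, j)"
      using ij aug_block_fun[OF ij(1)] by (simp add: mult_matrix_def aug_def flip: sum_distrib_right)
    finally show ?thesis .
  qed
  moreover have "conv (block_fun i) (conv (quad \<theta>) (block_fun j)) \<one> = conv u v \<one> + n * aug (block_fun i) * aug (block_fun j)"
  proof -
    have cq: "class_fun (quad \<theta>)" by (rule parity_class_fun[OF parity_quad[OF \<theta>]])
    have cb: "class_fun (block_fun i)" "class_fun (block_fun j)" using class_fun_block_fun ij by blast+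
    have "conv (quad \<theta>) (block_fun j) = (\<lambda>g. conv (block_fun j) (conv \<theta> \<theta>) g + n * aug (block_fun j) * norm_fun g)"
      unfolding n_def conv_comm[OF cb(2), of "quad \<theta>"] by (rule conv_quad[OF \<theta> cb(2)])
    then have "conv (block_fun i) (conv (quad \<theta>) (block_fun j))
        = (\<lambda>g. conv (block_fun i) (conv (block_fun j) (conv \<theta> \<theta>)) g + n * aug (block_fun j) * (aug (block_fun i) * norm_fun g))"
      by (simp add: conv_add conv_scale conv_norm)
    moreover have "conv (block_fun i) (conv (block_fun j) (conv \<theta> \<theta>)) = conv u v"
    proof -
      have "conv (block_fun j) (conv \<theta> \<theta>) = conv \<theta> v"
        unfolding v_def conv_left_comm[OF cb(2) cf] conv_comm[OF cb(2), of \<theta>] ..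
      then have "conv (block_fun i) (conv (block_fun j) (conv \<theta> \<theta>)) = conv (conv (block_fun i) \<theta>) v"
        by (simp add: conv_assoc)
      then show ?thesis by (simp add: u_def conv_comm[OF cb(1), of \<theta>])
    qed
    ultimately show ?thesis by (simp add: norm_fun_def)
  qed
  moreover have "conv u v \<one> = (\<Sum>a<K. if a = 0 then 0 else - weight a * (u (rep a) * v (rep a)))"
  proof -
    have "conv u v \<one> = - aug (\<lambda>g. u g * v g)"
      using v by (simp add: conv_at_one parity_def aug_def sum_negf)
    also have "\<dots> = (\<Sum>a<K. - weight a * (u (rep a) * v (rep a)))"
      unfolding aug_even[OF ev] by (simp add: aug_block_fun sum_negf mult.commute)
    also have "\<dots> = (\<Sum>a<K. if a = 0 then 0 else - weight a * (u (rep a) * v (rep a)))"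
      by (rule sum.cong) (auto simp: rep_0 one0)
    finally show ?thesis .
  qed
  moreover have "n * aug (block_fun i) * aug (block_fun j) = (\<Sum>a<K. if a = 0 then n * aug (block_fun i) * aug (block_fun j) else 0)"
    using K_pos by simp
  ultimately have "weight i * mult_matrix (quad \<theta>) $$ (i, j)
      = (\<Sum>a<K. (if a = 0 then 0 else - weight a * (u (rep a) * v (rep a)))
        + (if a = 0 then n * aug (block_fun i) * aug (block_fun j) else 0))"
    by (simp only: sum.distrib)
  also have "\<dots> = (\<Sum>a<K. odd_matrix \<theta> $$ (a, i) * ((if a = 0 then n else - weight a) * odd_matrix \<theta> $$ (a, j)))"
    using ij by (intro sum.cong refl) (auto simp: odd_matrix_def u_def v_def)
  finally show ?thesis unfolding n_def by (rule sym)
qed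

text \<open>Since block 0 has size 1, the nonzero product of the block sizes cancels from the determinants of the
  two diagonal forms and leaves only the signs and the group order.\<close>
lemma det_quad:
  assumes \<theta>: "parity (- 1) \<theta>"
  shows "det (mult_matrix (quad \<theta>)) = det (odd_matrix \<theta>) ^ 2 * ((- 1) ^ (K - 1) * int (order G))"
proof -
  let ?W = "\<lambda>a. if a = 0 then int (order G) else - weight a"
  let ?WT = "mat K K (\<lambda>(i, j). ?W i * odd_matrix \<theta> $$ (i, j))"
  have "transpose_mat (odd_matrix \<theta>) * ?WT = mat K K (\<lambda>(i, j). weight i * mult_matrix (quad \<theta>) $$ (i, j))"
  proof (rule eq_matI)
    fix i j assume "i < dim_row (mat K K (\<lambda>(i, j). weight i * mult_matrix (quad \<theta>) $$ (i, j)))"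
      "j < dim_col (mat K K (\<lambda>(i, j). weight i * mult_matrix (quad \<theta>) $$ (i, j)))"
    then have ij: "i < K" "j < K" by auto
    then show "(transpose_mat (odd_matrix \<theta>) * ?WT) $$ (i, j) = mat K K (\<lambda>(i, j). weight i * mult_matrix (quad \<theta>) $$ (i, j)) $$ (i, j)"
      using gram_identity[OF \<theta> ij] by (simp add: scalar_prod_def atLeast0LessThan)
  qed (simp_all add: odd_matrix_def)
  then have "det (odd_matrix \<theta>) * ((\<Prod>a<K. ?W a) * det (odd_matrix \<theta>)) = (\<Prod>a<K. weight a) * det (mult_matrix (quad \<theta>))"
    using det_mult[of "transpose_mat (odd_matrix \<theta>)" K ?WT] det_transpose[OF odd_matrix_carrier[of \<theta>]]
      det_scale_rows[OF odd_matrix_carrier[of \<theta>], of ?W] det_scale_rows[OF mult_matrix_carrier[of "quad \<theta>"], of weight]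
    by simp
  moreover have "(\<Prod>a<K. ?W a) = (- 1) ^ (K - 1) * int (order G) * (\<Prod>a<K. weight a)"
  proof -
    have K: "{..<K} = insert 0 {1..<K}" using K_pos by auto
    have "(\<Prod>a\<in>{1..<K}. ?W a) = (\<Prod>a\<in>{1..<K}. - 1 * weight a)" by (rule prod.cong) auto
    also have "\<dots> = (- 1) ^ (K - 1) * (\<Prod>a\<in>{1..<K}. weight a)"
      unfolding prod.distrib by simp
    finally show ?thesis unfolding K by (simp add: weight_0)
  qed
  moreover have "(\<Prod>a<K. weight a) \<noteq> 0" using weight_pos by (simp add: less_imp_neq[symmetric])
  ultimately show ?thesis by (auto simp: power2_eq_square algebra_simps)
qed

end

section \<open>The power map of an odd prime\<close>

locale prime_power_map = block_reps +
  fixes q :: nat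
  assumes q_prime: "prime q" and q_odd: "2 < q" and q_coprime: "coprime q (order G)"
begin

definition block_perm :: "nat \<Rightarrow> nat"
  where "block_perm i = (SOME j. j < K \<and> rep i [^] q \<in> block (rep j))"

definition block_sign :: "nat \<Rightarrow> int"
  where "block_sign i = (if rep i [^] q \<in> conj_class G (rep (block_perm i)) then 1 else - 1)"

lemma block_perm_spec:
  assumes "i < K"
  shows "block_perm i < K" "rep i [^] q \<in> block (rep (block_perm i))"
proof -
  have "\<exists>j. j < K \<and> rep i [^] q \<in> block (rep j)" using ex_rep rep_closed[OF assms] by simp
  from someI_ex[OF this] show "block_perm i < K" "rep i [^] q \<in> block (rep (block_perm i))"
    by (simp_all add: block_perm_def)
qed

lemma block_block_perm:
  assumes "i < K"
  shows "block (rep (block_perm i)) = block (rep i [^] q)"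
  using block_eq[OF rep_closed[OF block_perm_spec(1)] block_perm_spec(2)] assms by simp

lemma inj_block_perm: "inj_on block_perm {..<K}"
proof (rule inj_onI)
  fix i j assume ij: "i \<in> {..<K}" "j \<in> {..<K}" "block_perm i = block_perm j"
  then have "rep i [^] q \<in> block (rep j [^] q)"
    using block_perm_spec(2)[of i] block_block_perm[of j] by simp
  then have "rep i \<in> block (rep j)"
    using power_in_block_iff[OF q_coprime] rep_closed ij by simp
  then show "i = j" using rep_unique[of i j "rep i"] block_self[OF rep_closed] ij by simp
qed

lemma block_perm_0: "block_perm 0 = 0"
proof -
  have "\<one> \<in> block (rep (block_perm 0))" using block_perm_spec(2)[OF K_pos] by (simp add: rep_0)
  then show ?thesis
    using rep_unique[OF block_perm_spec(1)[OF K_pos] K_pos, of \<one>] by (simp add: rep_0 block_one)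
qed

lemma block_sign_0: "block_sign 0 = 1"
  using conj_class_self[of \<one>] by (simp add: block_sign_def block_perm_0 rep_0)

lemma block_sign_cases: "block_sign i = 1 \<or> block_sign i = - 1"
  by (simp add: block_sign_def)

lemma odd_fun_at_power:
  assumes "parity (- 1) f" "i < K"
  shows "f (rep i [^] q) = block_sign i * f (rep (block_perm i))"
proof (cases "rep i [^] q \<in> conj_class G (rep (block_perm i))")
  case True
  then show ?thesis
    using class_fun_on_class[OF parity_class_fun[OF assms(1)] rep_closed[OF block_perm_spec(1)[OF assms(2)]]]
    by (simp add: block_sign_def)
next
  case False
  have c: "rep (block_perm i) \<in> carrier G" by (rule rep_closed[OF block_perm_spec(1)[OF assms(2)]])
  have "rep i [^] q \<in> conj_class G (inv (rep (block_perm i)))"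
    using block_perm_spec(2)[OF assms(2)] False by (simp add: block_def)
  then have "f (rep i [^] q) = f (inv (rep (block_perm i)))"
    using class_fun_on_class[OF parity_class_fun[OF assms(1)], of "inv (rep (block_perm i))"] c by simp
  then show ?thesis using False assms(1) c by (simp add: block_sign_def parity_def)
qed

lemma cpow_block_fun:
  assumes "j < K"
  shows "fun_cong (cpow (block_fun j) q) (block_fun (block_perm j)) q"
proof (rule power_class_fun_cong[OF q_coprime])
  fix g assume g: "g \<in> carrier G"
  have "block_fun (block_perm j) (g [^] q) = block_fun j g"
    using power_in_block_iff[OF q_coprime rep_closed[OF assms] g] block_block_perm[OF assms] by (simp add: block_fun_def)
  then show "[cpow (block_fun j) q (g [^] q) = block_fun (block_perm j) (g [^] q)] (mod int q)"
    using cpow_prime[OF fin q_prime q_coprime class_fun_block_fun[OF assms] g] by simp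
qed

lemma q_half: "2 * ((q - 1) div 2) = q - 1" "2 * ((q - 1) div 2) + 1 = q"
  using prime_odd_nat[OF q_prime q_odd] q_odd by (auto elim!: oddE)

text \<open>Row \<open>i > 0\<close> evaluates \<open>\<theta>\<^sup>q b\<close> at the \<open>q\<close>-th power of representative \<open>i\<close>, where \<open>b\<close> is the indicator
  function of the image of block \<open>j\<close>. As \<open>b\<close> is congruent to the \<open>q\<close>-th power of the indicator function \<open>b\<^sub>j\<close>
  of block \<open>j\<close>, Frobenius gives the value of \<open>\<theta> b\<^sub>j\<close> at representative \<open>i\<close>. In row 0 everything is read
  through the augmentation, and \<open>quad \<theta>\<close> acts by the square of the group order, whose \<open>r\<close>-th power, \<open>r = (q - 1) / 2\<close>, is 1 by Fermat's theorem.\<close>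
lemma frobenius_identity:
  assumes \<theta>: "parity (- 1) \<theta>" and ij: "i < K" "j < K"
  shows "[block_sign i * (odd_matrix \<theta> * mult_matrix (cpow (quad \<theta>) ((q - 1) div 2))) $$ (block_perm i, block_perm j)
    = odd_matrix \<theta> $$ (i, j)] (mod int q)"
proof -
  define r where "r = (q - 1) div 2"
  define y where "y = cpow (quad \<theta>) r"
  have y: "parity 1 y" unfolding y_def using parity_cpow[OF parity_quad[OF \<theta>], of r] by simp
  have pj: "parity 1 (conv y (block_fun j))" if "j < K" for j
    using parity_conv[OF y parity_block_fun[OF that]] by simp
  have TM: "(odd_matrix \<theta> * mult_matrix y) $$ (block_perm i, block_perm j)
      = (if block_perm i = 0 then aug (conv y (block_fun (block_perm j))) else conv \<theta> (conv y (block_fun (block_perm j))) (rep (block_perm i)))"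
    unfolding mult_matrix_def using block_perm_spec(1) ij pj by (intro odd_matrix_mult_even) auto
  show ?thesis
  proof (cases "i = 0")
    case True
    have "[int (order G) ^ (q - 1) = 1] (mod int q)"
      by (rule fermat_coprime[OF q_prime]) (use q_coprime in \<open>simp add: coprime_commute\<close>)
    moreover have "aug y = int (order G) ^ (q - 1)"
      unfolding y_def aug_cpow[OF fin] aug_quad[OF \<theta>] power_mult[symmetric] r_def q_half(1) ..
    moreover have "[aug (block_fun (block_perm j)) = aug (block_fun j)] (mod int q)"
    proof -
      have "[aug (block_fun (block_perm j)) = aug (block_fun j) ^ q] (mod int q)"
        using cong_sym[OF fun_cong_aug[OF cpow_block_fun[OF ij(2)]]] by (simp add: aug_cpow[OF fin])
      then show ?thesis using cong_power_prime[OF q_prime] cong_trans by blast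
    qed
    ultimately have "[aug y * aug (block_fun (block_perm j)) = 1 * aug (block_fun j)] (mod int q)"
      by (intro cong_mult) simp_all
    then show ?thesis
      using TM True ij by (simp add: block_perm_0 block_sign_0 aug_conv odd_matrix_def y_def r_def)
  next
    case False
    then have p0: "block_perm i \<noteq> 0" using inj_onD[OF inj_block_perm, of i 0] block_perm_0 ij K_pos by auto
    define f where "f = conv (cpow \<theta> q) (block_fun (block_perm j))"
    have "conv \<theta> (conv y (block_fun (block_perm j))) = f"
      unfolding f_def y_def conv_assoc[symmetric] odd_conv_cpow_quad[OF \<theta>] r_def q_half(2) ..
    then have "(odd_matrix \<theta> * mult_matrix y) $$ (block_perm i, block_perm j) = f (rep (block_perm i))"
      using TM p0 by simp
    moreover have "parity (- 1) f"
      using parity_conv[OF parity_cpow[OF \<theta>, of q] parity_block_fun[OF block_perm_spec(1)[OF ij(2)]]]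
        prime_odd_nat[OF q_prime q_odd] by (simp add: f_def)
    ultimately have 1: "block_sign i * (odd_matrix \<theta> * mult_matrix y) $$ (block_perm i, block_perm j) = f (rep i [^] q)"
      using odd_fun_at_power[OF _ ij(1)] by simp
    note cf = parity_class_fun[OF \<theta>] class_fun_block_fun[OF ij(2)]
    have "fun_cong f (conv (cpow \<theta> q) (cpow (block_fun j) q)) q"
      unfolding f_def by (intro fun_cong_conv fun_cong_refl fun_cong_sym[OF cpow_block_fun[OF ij(2)]])
    moreover have "conv (cpow \<theta> q) (cpow (block_fun j) q) = cpow (conv \<theta> (block_fun j)) q"
      using cpow_conv[OF cf fin] by simp
    ultimately have "[f (rep i [^] q) = cpow (conv \<theta> (block_fun j)) q (rep i [^] q)] (mod int q)"
      using rep_closed[OF ij(1)] by (simp add: fun_cong_def)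
    moreover have "[cpow (conv \<theta> (block_fun j)) q (rep i [^] q) = conv \<theta> (block_fun j) (rep i)] (mod int q)"
      by (rule cpow_prime[OF fin q_prime q_coprime class_fun_conv[OF cf] rep_closed[OF ij(1)]])
    moreover have "odd_matrix \<theta> $$ (i, j) = conv \<theta> (block_fun j) (rep i)" using ij False by (simp add: odd_matrix_def)
    ultimately show ?thesis using 1 cong_trans unfolding y_def r_def by metis
  qed
qed

text \<open>These functions, for \<open>0 < i < K\<close>, form a basis of the odd functions.\<close>
definition odd_class_fun :: "nat \<Rightarrow> 'a \<Rightarrow> int"
  where "odd_class_fun i g = of_bool (g \<in> conj_class G (rep i)) - of_bool (g \<in> conj_class G (inv (rep i)))"

lemma parity_odd_class_fun:
  assumes "i < K"
  shows "parity (- 1) (odd_class_fun i)"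
proof -
  have c: "rep i \<in> carrier G" "inv (rep i) \<in> carrier G" using rep_closed[OF assms] by auto
  have "odd_class_fun i g = 0" if "g \<notin> carrier G" for g
    using that conj_class_subset[OF c(1)] conj_class_subset[OF c(2)] by (auto simp: odd_class_fun_def)
  moreover have "odd_class_fun i (inv g) = - odd_class_fun i g" if "g \<in> carrier G" for g
    using inv_in_conj_class_iff[OF c(1) that] inv_in_conj_class_iff[OF c(2) that] c by (simp add: odd_class_fun_def)
  ultimately show ?thesis
    using conj_in_conj_class_iff[OF c(1)] conj_in_conj_class_iff[OF c(2)]
    by (simp add: parity_def class_fun_def odd_class_fun_def)
qed

lemma rep_eq_one_iff: "i < K \<Longrightarrow> rep i = \<one> \<longleftrightarrow> i = 0"
  using rep_unique[of i 0 \<one>] K_pos by (auto simp: rep_0 block_one)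

lemma inv_rep_not_conj:
  assumes "0 < i" "i < K"
  shows "inv (rep i) \<notin> conj_class G (rep i)"
  using real_element_trivial[OF rep_closed[OF assms(2)]] rep_eq_one_iff[OF assms(2)] assms(1) by auto

lemma odd_class_fun_rep:
  assumes "0 < i" "i < K" "a < K"
  shows "odd_class_fun i (rep a) = of_bool (a = i)"
proof (cases "a = i")
  case True
  then show ?thesis
    using inv_in_conj_class_iff[OF rep_closed[OF assms(2)] rep_closed[OF assms(2)]]
      inv_rep_not_conj[OF assms(1,2)] conj_class_self[OF rep_closed[OF assms(2)]]
    by (simp add: odd_class_fun_def)
next
  case False
  then have "rep a \<notin> block (rep i)"
    using rep_unique[OF assms(3,2) block_self[OF rep_closed[OF assms(3)]]] by blast
  then show ?thesis using False by (simp add: odd_class_fun_def block_def)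
qed

text \<open>A right inverse modulo \<open>q\<close> is written down column by column: the norm element divided by the group
  order maps to the coordinate vector number 0, and an odd basis function has a preimage by \<open>ex_generic_odd_fun\<close>.\<close>
lemma ex_odd_matrix_coprime:
  obtains \<theta> where "parity (- 1) \<theta>" "coprime (det (odd_matrix \<theta>)) (int q)"
proof -
  obtain \<theta> where \<theta>: "parity (- 1) \<theta>"
    and gen: "\<And>\<psi>. parity (- 1) \<psi> \<Longrightarrow> \<exists>\<chi>. parity (- 1) \<chi> \<and> fun_cong (conv \<theta> (conv \<chi> \<psi>)) \<psi> q"
    using ex_generic_odd_fun[OF fin q_prime q_coprime q_odd] by blast
  have "\<exists>z. parity 1 z \<and> [aug z = of_bool (i = 0)] (mod int q) \<and>
      (\<forall>a. 0 < a \<and> a < K \<longrightarrow> [conv \<theta> z (rep a) = of_bool (a = i)] (mod int q))" if i: "i < K" for i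
  proof (cases "i = 0")
    case True
    have "coprime (int (order G)) (int q)" using q_coprime by (simp add: coprime_commute)
    then obtain n' where n': "[int (order G) * n' = 1] (mod int q)" using cong_solve_coprime_int by blast
    define z where "z = (\<lambda>g. n' * norm_fun g)"
    have "parity 1 z" unfolding z_def by (intro parity_scale parity_norm)
    moreover have "aug z = int (order G) * n'"
      using aug_norm by (simp add: z_def aug_def flip: sum_distrib_left)
    moreover have "conv \<theta> z = (\<lambda>_. 0)"
      by (simp add: z_def conv_scale conv_norm aug_odd[OF \<theta>])
    ultimately show ?thesis using n' True by (intro exI[of _ z]) auto
  next
    case False
    obtain \<chi> where \<chi>: "parity (- 1) \<chi>" "fun_cong (conv \<theta> (conv \<chi> (odd_class_fun i))) (odd_class_fun i) q"
      using gen[OF parity_odd_class_fun[OF i]] by blast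
    have "parity 1 (conv \<chi> (odd_class_fun i))" using parity_conv[OF \<chi>(1) parity_odd_class_fun[OF i]] by simp
    moreover have "aug (conv \<chi> (odd_class_fun i)) = 0" by (simp add: aug_conv aug_odd[OF \<chi>(1)])
    moreover have "[conv \<theta> (conv \<chi> (odd_class_fun i)) (rep a) = of_bool (a = i)] (mod int q)" if "a < K" for a
    proof -
      have "[conv \<theta> (conv \<chi> (odd_class_fun i)) (rep a) = odd_class_fun i (rep a)] (mod int q)"
        using \<chi>(2) rep_closed[OF that] by (simp add: fun_cong_def)
      moreover have "odd_class_fun i (rep a) = of_bool (a = i)" using odd_class_fun_rep[OF _ i that] False by simp
      ultimately show ?thesis by (simp only:)
    qed
    ultimately show ?thesis using False by (intro exI[of _ "conv \<chi> (odd_class_fun i)"]) simp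
  qed
  then have "\<forall>i. \<exists>z. i < K \<longrightarrow> parity 1 z \<and> [aug z = of_bool (i = 0)] (mod int q) \<and>
      (\<forall>a. 0 < a \<and> a < K \<longrightarrow> [conv \<theta> z (rep a) = of_bool (a = i)] (mod int q))" by blast
  from choice[OF this] obtain z where z: "\<And>i. i < K \<Longrightarrow> parity 1 (z i)"
    "\<And>i. i < K \<Longrightarrow> [aug (z i) = of_bool (i = 0)] (mod int q)"
    "\<And>i a. i < K \<Longrightarrow> 0 < a \<Longrightarrow> a < K \<Longrightarrow> [conv \<theta> (z i) (rep a) = of_bool (a = i)] (mod int q)"
    by blast
  let ?Z = "mat K K (\<lambda>(i, j). z j (rep i))"
  have "[det (odd_matrix \<theta> * ?Z) = det (1\<^sub>m K)] (mod int q)"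
  proof (rule det_cong_mod[of _ K])
    fix i j assume ij: "i < K" "j < K"
    have "[(if i = 0 then aug (z j) else conv \<theta> (z j) (rep i)) = of_bool (i = j)] (mod int q)"
      using z(2)[OF ij(2)] z(3)[OF ij(2) _ ij(1)] by (cases "i = 0") auto
    moreover have "(odd_matrix \<theta> * ?Z) $$ (i, j) = (if i = 0 then aug (z j) else conv \<theta> (z j) (rep i))"
      by (rule odd_matrix_mult_even[OF z(1) ij])
    moreover have "1\<^sub>m K $$ (i, j) = (of_bool (i = j) :: int)" using ij by simp
    ultimately show "[(odd_matrix \<theta> * ?Z) $$ (i, j) = 1\<^sub>m K $$ (i, j)] (mod int q)"
      by (simp only:)
  qed auto
  then have "[det (odd_matrix \<theta>) * det ?Z = 1] (mod int q)"
    by (simp add: det_mult[of _ K])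
  then have "coprime (det (odd_matrix \<theta>)) (int q)"
    using coprime_iff_invertible_int by blast
  then show ?thesis using that \<theta> by blast
qed

text \<open>Take determinants in \<open>frobenius_identity\<close>, insert \<open>det_quad\<close>, and cancel the determinant \<open>D\<close> of the odd
  matrix, whose power \<open>D\<^sup>q\<^sup>-\<^sup>1\<close> is 1 modulo \<open>q\<close>.\<close>
lemma prod_block_sign_cong:
  "[(\<Prod>i<K. block_sign i) = ((- 1) ^ (K - 1) * int (order G)) ^ ((q - 1) div 2)] (mod int q)"
proof -
  obtain \<theta> where \<theta>: "parity (- 1) \<theta>" and cop: "coprime (det (odd_matrix \<theta>)) (int q)"
    by (rule ex_odd_matrix_coprime)
  define D where "D = det (odd_matrix \<theta>)"
  define r where "r = (q - 1) div 2"
  define c where "c = (- 1) ^ (K - 1) * int (order G)"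
  define e where "e = (\<Prod>i<K. block_sign i)"
  define A where "A = odd_matrix \<theta> * mult_matrix (cpow (quad \<theta>) r)"
  have A: "A \<in> carrier_mat K K" unfolding A_def by (rule mult_carrier_mat[of _ K K]) simp_all
  let ?B = "mat K K (\<lambda>(i, j). A $$ (block_perm i, block_perm j))"
  have "det (mat K K (\<lambda>(i, j). block_sign i * ?B $$ (i, j))) = e * det A"
    using det_scale_rows[of ?B K block_sign] det_permute_both[OF A block_perm_spec(1) inj_block_perm] by (simp add: e_def)
  moreover have "det A = D * (D ^ 2 * c) ^ r"
    by (simp add: A_def det_mult[of _ K] det_mult_matrix_cpow[OF parity_quad[OF \<theta>]] det_quad[OF \<theta>] D_def c_def)
  moreover have "[det (mat K K (\<lambda>(i, j). block_sign i * ?B $$ (i, j))) = D] (mod int q)"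
    unfolding D_def
    by (rule det_cong_mod[of _ K]) (use frobenius_identity[OF \<theta>] in \<open>simp_all add: A_def r_def\<close>)
  ultimately have "[D * (e * (D ^ 2 * c) ^ r) = D * 1] (mod int q)"
    by (simp add: mult.left_commute)
  then have "[e * (D ^ 2 * c) ^ r = 1] (mod int q)"
    using cong_mult_lcancel[OF cop[folded D_def]] by blast
  moreover have "(D ^ 2 * c) ^ r = D ^ (q - 1) * c ^ r"
    unfolding power_mult_distrib power_mult[symmetric] r_def q_half(1) ..
  moreover have "[e * (D ^ (q - 1) * c ^ r) = e * (1 * c ^ r)] (mod int q)"
    by (intro cong_mult cong_refl fermat_coprime[OF q_prime] cop[folded D_def])
  ultimately have "[e * c ^ r = 1] (mod int q)" by (metis cong_sym cong_trans mult_1)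
  then have "[e * (e * c ^ r) = e * 1] (mod int q)" by (intro cong_mult cong_refl)
  moreover have "e * e = 1"
  proof -
    have "block_sign i * block_sign i = 1" for i using block_sign_cases[of i] by auto
    then show ?thesis by (simp add: e_def flip: prod.distrib)
  qed
  ultimately show ?thesis unfolding e_def[symmetric] c_def[symmetric] r_def[symmetric]
    by (simp add: cong_sym flip: mult.assoc)
qed

end

section \<open>The sign of the power map on conjugacy classes\<close>

context prime_power_map
begin

definition class_of_rep :: "nat \<Rightarrow> 'a set"
  where "class_of_rep i = conj_class G (rep i)"

lemma inj_class_of_rep: "inj_on class_of_rep {1..<K}"
proof (rule inj_onI)
  fix i j assume ij: "i \<in> {1..<K}" "j \<in> {1..<K}" "class_of_rep i = class_of_rep j"
  then have "rep i \<in> conj_class G (rep j)"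
    using conj_class_eq_iff rep_closed by (simp add: class_of_rep_def)
  then show "i = j"
    using rep_unique[of i j "rep i"] block_self[OF rep_closed] ij by (simp add: block_def)
qed

lemma class_power_rep:
  assumes "g \<in> carrier G"
  shows "restrict_id (class_power G (int q)) (conj_classes G) (conj_class G g) = conj_class G (g [^] q)"
  using assms by (simp add: conj_classes_def class_power_conj_class int_pow_int)

text \<open>The classes of the nontrivial representatives are the half \<open>A\<close> in \<open>sign_commuting_with_involution\<close>, and
  inversion of classes is the involution. That \<open>A\<close> does not meet the inverse half is where the oddness
  of the group order enters.\<close>
lemma sign_class_power:
  "sign (restrict_id (class_power G (int q)) (conj_classes G)) = (\<Prod>i<K. block_sign i)"
proof -
  let ?\<sigma> = "restrict_id (class_power G (int q)) (conj_classes G)"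
  define A where "A = class_of_rep ` {1..<K}"
  have cop: "coprime (int q) (int (order G))" using q_coprime by simp
  have iA: "class_inv ` A = (\<lambda>i. conj_class G (inv (rep i))) ` {1..<K}"
    unfolding A_def image_image by (rule image_cong) (simp_all add: class_of_rep_def class_inv_conj_class rep_closed)
  have disj: "conj_class G (rep i) \<noteq> conj_class G (inv (rep j))" if ij: "1 \<le> i" "i < K" "j < K" for i j
  proof
    assume eq: "conj_class G (rep i) = conj_class G (inv (rep j))"
    then have m: "rep i \<in> conj_class G (inv (rep j))"
      using conj_class_eq_iff[of "rep i" "inv (rep j)"] rep_closed ij by simp
    then have "i = j"
      using rep_unique[of i j "rep i"] block_self[OF rep_closed] ij by (simp add: block_def)
    then have "inv (rep i) \<in> conj_class G (rep i)"
      using eq conj_class_self[of "inv (rep i)"] rep_closed ij by simp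
    then show False using inv_rep_not_conj[of i] ij by simp
  qed
  have notin: "conj_class G (rep j) \<notin> class_inv ` A" if j: "1 \<le> j" "j < K" for j
  proof
    assume "conj_class G (rep j) \<in> class_inv ` A"
    then obtain k where "k < K" "conj_class G (rep j) = conj_class G (inv (rep k))"
      unfolding iA by auto
    then show False using disj[of j k] j by simp
  qed
  have one: "conj_class G \<one> \<noteq> conj_class G x" if "x \<in> carrier G" "x \<noteq> \<one>" for x
    using conj_class_eq_iff[of x \<one>] that by (auto simp: conj_class_eq)
  have s: "sign ?\<sigma> = (- 1) ^ card {C \<in> A. ?\<sigma> C \<in> class_inv ` A}"
  proof (rule sign_commuting_with_involution[where X = "conj_classes G" and z = "conj_class G \<one>"])
    show "finite A" by (simp add: A_def)
    show "?\<sigma> permutes conj_classes G" by (rule class_power_permutes[OF fin cop])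
    show "conj_classes G = insert (conj_class G \<one>) (A \<union> class_inv ` A)"
    proof (intro equalityI subsetI)
      fix C assume "C \<in> conj_classes G"
      then obtain x where x: "x \<in> carrier G" "C = conj_class G x" by (auto simp: conj_classes_def)
      obtain i where i: "i < K" "x \<in> block (rep i)" using ex_rep[OF x(1)] by blast
      show "C \<in> insert (conj_class G \<one>) (A \<union> class_inv ` A)"
      proof (cases "i = 0")
        case True
        then show ?thesis using i x by (simp add: rep_0 block_one)
      next
        case False
        have "C = conj_class G (rep i) \<or> C = conj_class G (inv (rep i))"
          using i x conj_class_eq_iff rep_closed[OF i(1)] by (auto simp: block_def)
        then show ?thesis unfolding iA using False i(1) by (auto simp: A_def class_of_rep_def)
      qed
    next
      fix C assume "C \<in> insert (conj_class G \<one>) (A \<union> class_inv ` A)"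
      then show "C \<in> conj_classes G"
        unfolding iA using rep_closed by (auto simp: A_def class_of_rep_def conj_classes_def)
    qed
    show "conj_class G \<one> \<notin> A"
    proof
      assume "conj_class G \<one> \<in> A"
      then obtain i where "1 \<le> i" "i < K" "conj_class G \<one> = conj_class G (rep i)"
        by (auto simp: A_def class_of_rep_def)
      then show False using one[of "rep i"] rep_closed[of i] rep_eq_one_iff[of i] by simp
    qed
    show "conj_class G \<one> \<notin> class_inv ` A"
    proof
      assume "conj_class G \<one> \<in> class_inv ` A"
      then obtain i where "1 \<le> i" "i < K" "conj_class G \<one> = conj_class G (inv (rep i))"
        unfolding iA by auto
      then show False using one[of "inv (rep i)"] rep_closed[of i] rep_eq_one_iff[of i]
        by (simp add: inv_eq_1_iff)
    qed
    show "A \<inter> class_inv ` A = {}"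
    proof -
      have "C \<notin> class_inv ` A" if "C \<in> A" for C
      proof -
        obtain i where "i \<in> {1..<K}" "C = conj_class G (rep i)"
          using \<open>C \<in> A\<close> unfolding A_def class_of_rep_def by blast
        then show ?thesis using notin[of i] by simp
      qed
      then show ?thesis by blast
    qed
    show "class_inv (class_inv C) = C" if "C \<in> conj_classes G" for C
      using that by (auto simp: conj_classes_def class_inv_conj_class)
    show "?\<sigma> (class_inv C) = class_inv (?\<sigma> C)" if C: "C \<in> conj_classes G" for C
    proof -
      obtain x where x: "x \<in> carrier G" "C = conj_class G x" using C by (auto simp: conj_classes_def)
      then show ?thesis by (simp add: class_inv_conj_class class_power_rep nat_pow_inv)
    qed
    show "?\<sigma> (conj_class G \<one>) = conj_class G \<one>" by (simp add: class_power_rep)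
    show "class_inv (conj_class G \<one>) = conj_class G \<one>" by (simp add: class_inv_conj_class)
  qed
  have neg: "?\<sigma> (class_of_rep i) \<in> class_inv ` A \<longleftrightarrow> block_sign i = - 1" if i: "i \<in> {1..<K}" for i
  proof -
    have iK: "i < K" using i by simp
    have c: "rep i \<in> carrier G" "rep (block_perm i) \<in> carrier G" "block_perm i < K"
      using block_perm_spec(1)[OF iK] rep_closed iK by auto
    have p0: "block_perm i \<noteq> 0" using inj_onD[OF inj_block_perm, of i 0] block_perm_0 i K_pos by auto
    have \<sigma>: "?\<sigma> (class_of_rep i) = conj_class G (rep i [^] q)"
      using c by (simp add: class_of_rep_def class_power_rep)
    show ?thesis
    proof (cases "rep i [^] q \<in> conj_class G (rep (block_perm i))")
      case True
      then have "conj_class G (rep i [^] q) = conj_class G (rep (block_perm i))"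
        using conj_class_eq_iff c by simp
      then show ?thesis using True notin[of "block_perm i"] p0 c unfolding \<sigma> by (simp add: block_sign_def)
    next
      case False
      then have "rep i [^] q \<in> conj_class G (inv (rep (block_perm i)))"
        using block_perm_spec(2)[OF iK] by (simp add: block_def)
      then have "conj_class G (rep i [^] q) = conj_class G (inv (rep (block_perm i)))"
        using conj_class_eq_iff c by simp
      then show ?thesis using False p0 c unfolding iA \<sigma> by (auto simp: block_sign_def)
    qed
  qed
  have "{C \<in> A. ?\<sigma> C \<in> class_inv ` A} = class_of_rep ` {i \<in> {1..<K}. block_sign i = - 1}"
  proof -
    have "{C \<in> A. ?\<sigma> C \<in> class_inv ` A} = class_of_rep ` {i \<in> {1..<K}. ?\<sigma> (class_of_rep i) \<in> class_inv ` A}"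
      unfolding A_def by blast
    also have "{i \<in> {1..<K}. ?\<sigma> (class_of_rep i) \<in> class_inv ` A} = {i \<in> {1..<K}. block_sign i = - 1}"
      using neg by blast
    finally show ?thesis .
  qed
  moreover have "inj_on class_of_rep {i \<in> {1..<K}. block_sign i = - 1}"
    using inj_class_of_rep by (rule inj_on_subset) blast
  ultimately have "card {C \<in> A. ?\<sigma> C \<in> class_inv ` A} = card {i \<in> {1..<K}. block_sign i = - 1}"
    by (simp only: card_image)
  moreover have "(\<Prod>i<K. block_sign i) = (- 1) ^ card {i \<in> {1..<K}. block_sign i = - 1}"
  proof -
    have K: "{..<K} = insert 0 {1..<K}" using K_pos by auto
    have "(\<Prod>i\<in>{1..<K}. block_sign i) = (\<Prod>i\<in>{1..<K}. if block_sign i = - 1 then - 1 else 1)"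
      using block_sign_cases by (intro prod.cong refl) auto
    also have "\<dots> = (- 1) ^ card {i \<in> {1..<K}. block_sign i = - 1}"
      by (simp add: prod.If_cases Int_def)
    finally show ?thesis unfolding K by (simp add: block_sign_0)
  qed
  ultimately show ?thesis using s by simp
qed

text \<open>The group order is 1 plus twice the sum of \<open>K - 1\<close> class sizes, all of them odd.\<close>
lemma minus_one_power_blocks: "(- 1 :: int) ^ (K - 1) = (- 1) ^ ((order G - 1) div 2)"
proof -
  define c where "c = (\<lambda>i. card (conj_class G (rep i)))"
  have w: "weight i = 2 * int (c i)" if i: "i \<in> {1..<K}" for i
  proof -
    have r: "rep i \<in> carrier G" using rep_closed i by simp
    have "conj_class G (rep i) \<inter> conj_class G (inv (rep i)) = {}"
    proof (rule ccontr)
      assume "conj_class G (rep i) \<inter> conj_class G (inv (rep i)) \<noteq> {}"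
      then obtain x where x: "x \<in> conj_class G (rep i)" "x \<in> conj_class G (inv (rep i))" by blast
      then have "conj_class G (rep i) = conj_class G (inv (rep i))"
        using conj_class_sym[OF r x(1)] conj_class_sym[OF _ x(2)] r by simp
      then show False using inv_rep_not_conj[of i] conj_class_self[of "inv (rep i)"] r i by simp
    qed
    moreover have "card (conj_class G (inv (rep i))) = c i"
      unfolding class_inv_conj_class[OF r, symmetric] class_inv_def c_def
      by (rule card_image) (rule inj_on_subset[OF _ conj_class_subset[OF r]], rule inj_onI, metis inv_inv)
    moreover have "finite (conj_class G x)" if "x \<in> carrier G" for x
      by (rule finite_subset[OF conj_class_subset[OF that] fin])
    ultimately show ?thesis using r by (simp add: weight_def block_def card_Un_disjoint c_def)
  qed
  have odd: "odd (c i)" if "i \<in> {1..<K}" for i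
    using card_conj_class_dvd[OF rep_closed, of i] that odd_order unfolding c_def by (auto intro: dvd_trans)
  have "int (order G) = (\<Sum>a<K. norm_fun (rep a) * weight a)"
    using aug_even[OF parity_norm] by (simp add: aug_norm aug_block_fun)
  also have "\<dots> = (\<Sum>a<K. weight a)"
    by (rule sum.cong) (simp_all add: norm_fun_def rep_closed)
  also have "{..<K} = insert 0 {1..<K}" using K_pos by auto
  also have "(\<Sum>a\<in>insert 0 {1..<K}. weight a) = 1 + (\<Sum>a\<in>{1..<K}. 2 * int (c a))"
    by (simp add: weight_0 w)
  finally have "int (order G) = int (1 + 2 * (\<Sum>a\<in>{1..<K}. c a))"
    by (simp add: sum_distrib_left)
  then have "order G = 1 + 2 * (\<Sum>a\<in>{1..<K}. c a)" by (simp only: of_nat_eq_iff)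
  then have "(order G - 1) div 2 = (\<Sum>a\<in>{1..<K}. c a)" by simp
  then have "(- 1 :: int) ^ ((order G - 1) div 2) = (\<Prod>a\<in>{1..<K}. (- 1) ^ c a)"
    by (simp add: power_sum)
  also have "\<dots> = (\<Prod>a\<in>{1..<K}. - 1)" using odd by (intro prod.cong) auto
  finally show ?thesis by simp
qed

lemma sign_class_power_jacobi:
  "sign (restrict_id (class_power G (int q)) (conj_classes G)) = jacobi_symbol (int q) (order G)"
proof -
  define c where "c = (- 1) ^ ((order G - 1) div 2) * int (order G)"
  have "[Legendre c (int q) = c ^ ((q - 1) div 2)] (mod int q)"
    by (rule euler_criterion[OF q_prime q_odd])
  then have "[(\<Prod>i<K. block_sign i) = Legendre c (int q)] (mod int q)"
    using prod_block_sign_cong unfolding c_def minus_one_power_blocks[symmetric] by (meson cong_sym cong_trans)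
  then have "(\<Prod>i<K. block_sign i) = Legendre c (int q)"
  proof (rule cong_imp_eq_signs)
    show "(\<Prod>i<K. block_sign i) \<in> {- 1, 0, 1}"
      unfolding sign_class_power[symmetric] by (simp add: sign_def)
  qed (use q_odd Legendre_values in auto)
  moreover have "\<not> q dvd order G"
    using q_coprime q_prime by (metis coprime_absorb_left not_prime_unit)
  ultimately show ?thesis
    using Legendre_signed_reciprocity[OF q_prime q_odd odd_order] by (simp add: sign_class_power c_def)
qed

end

section \<open>The quadratic symbol\<close>

context group
begin

lemma quadratic_symbol_eq_sign:
  assumes "coprime a (int (order G))"
  shows "quadratic_symbol a G = sign (restrict_id (class_power G a) (conj_classes G))"
  using assms by (simp add: quadratic_symbol_def sign_def)

lemma quadratic_symbol_mult:
  assumes "finite (carrier G)" "coprime a (int (order G))" "coprime b (int (order G))"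
  shows "quadratic_symbol (a * b) G = quadratic_symbol a G * quadratic_symbol b G"
proof -
  let ?\<sigma> = "\<lambda>a. restrict_id (class_power G a) (conj_classes G)"
  have eq: "?\<sigma> (a * b) = ?\<sigma> a \<circ> ?\<sigma> b"
  proof
    fix C
    show "?\<sigma> (a * b) C = (?\<sigma> a \<circ> ?\<sigma> b) C"
    proof (cases "C \<in> conj_classes G")
      case True
      then obtain x where x: "x \<in> carrier G" "C = conj_class G x" by (auto simp: conj_classes_def)
      have "(x [^] b) [^] a = x [^] (a * b)" using int_pow_pow[OF x(1), of b a] by (simp add: mult.commute)
      then show ?thesis using x by (simp add: conj_classes_def class_power_conj_class)
    qed simp
  qed
  have "finite (conj_classes G)" using assms(1) by (simp add: conj_classes_def)
  then have "permutation (?\<sigma> a)" "permutation (?\<sigma> b)"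
    using class_power_permutes[OF assms(1)] assms(2,3) permutes_imp_permutation by blast+
  then have "sign (?\<sigma> (a * b)) = sign (?\<sigma> a) * sign (?\<sigma> b)"
    unfolding eq by (rule sign_compose)
  then show ?thesis using assms by (simp add: quadratic_symbol_eq_sign)
qed

lemma quadratic_symbol_cong:
  assumes "[a = b] (mod int (order G))"
  shows "quadratic_symbol a G = quadratic_symbol b G"
proof -
  obtain k where k: "a = b + int (order G) * k" using assms cong_iff_lin[of b a] cong_sym by metis
  have "x [^] a = x [^] b" if x: "x \<in> carrier G" for x
  proof -
    have "x [^] int (order G) = \<one>" using pow_order_eq_1[OF x] by (simp add: int_pow_int)
    then have "x [^] (int (order G) * k) = \<one>"
      using int_pow_pow[OF x, of "int (order G)" k] by (simp add: int_pow_one)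
    then show ?thesis unfolding k using x int_pow_mult[OF x, of b "int (order G) * k"] by simp
  qed
  then have "class_power G a C = class_power G b C" if "C \<in> conj_classes G" for C
    using that by (auto simp: conj_classes_def class_power_conj_class)
  then have "restrict_id (class_power G a) (conj_classes G) = restrict_id (class_power G b) (conj_classes G)"
    by (intro restrict_id_cong) auto
  moreover have "coprime a (int (order G)) \<longleftrightarrow> coprime b (int (order G))"
    using cong_imp_coprime[OF assms] cong_imp_coprime[OF cong_sym[OF assms]] by blast
  ultimately show ?thesis by (simp add: quadratic_symbol_def)
qed

end

context odd_group
begin

lemma quadratic_symbol_prime:
  assumes "prime q" "2 < q" "coprime q (order G)"
  shows "quadratic_symbol (int q) G = jacobi_symbol (int q) (order G)"
proof -
  obtain K :: nat and rep :: "nat \<Rightarrow> 'a" where "0 < K" "rep 0 = \<one>"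
    "\<And>i. i < K \<Longrightarrow> rep i \<in> carrier G" "\<And>x. x \<in> carrier G \<Longrightarrow> \<exists>i<K. x \<in> block (rep i)"
    "\<And>i j x. i < K \<Longrightarrow> j < K \<Longrightarrow> x \<in> block (rep i) \<Longrightarrow> x \<in> block (rep j) \<Longrightarrow> i = j"
    using ex_block_representatives by blast
  then interpret prime_power_map G K rep q
    using assms by unfold_locales
  show ?thesis
    using sign_class_power_jacobi assms(3) by (simp add: quadratic_symbol_eq_sign)
qed

text \<open>Splitting off prime factors keeps them odd, which is why even numbers are excluded here: the prime 2
  itself is outside the reach of \<open>quadratic_symbol_prime\<close>.\<close>
lemma quadratic_symbol_odd:
  assumes "odd (m :: nat)" "coprime m (order G)"
  shows "quadratic_symbol (int m) G = jacobi_symbol (int m) (order G)"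
  using assms
proof (induction m rule: prime_divisors_induct)
  case zero
  then show ?case by simp
next
  case (unit m)
  then have "m = 1" by simp
  moreover have "quadratic_symbol 1 G * quadratic_symbol 1 G = quadratic_symbol 1 G"
    using quadratic_symbol_mult[OF fin, of 1 1] by simp
  moreover have "quadratic_symbol 1 G \<noteq> 0" by (simp add: quadratic_symbol_def)
  moreover have "jacobi_symbol 1 (order G) = 1"
    unfolding jacobi_symbol_def
    by (rule prod_mset.neutral) (auto intro!: Legendre_1 simp: in_prime_factors_iff)
  ultimately show ?case by simp
next
  case (factor p m)
  have "p \<noteq> 2" using factor.prems(1) by auto
  then have "2 < p" using prime_ge_2_nat[OF factor.hyps(1)] by simp
  moreover have cop: "coprime p (order G)" "coprime m (order G)" using factor.prems(2) by auto
  ultimately have "quadratic_symbol (int p) G = jacobi_symbol (int p) (order G)"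
    using quadratic_symbol_prime factor.hyps by blast
  moreover have "quadratic_symbol (int m) G = jacobi_symbol (int m) (order G)"
    using factor cop by simp
  ultimately show ?case
    using cop by (simp add: quadratic_symbol_mult[OF fin] jacobi_symbol_mult[OF odd_order])
qed

end

theorem mainTheorem3:
  fixes G :: "('a, 'b) monoid_scheme" and a :: int
  assumes "group G" and "finite (carrier G)" and "odd (order G)"
  shows "quadratic_symbol a G = jacobi_symbol a (order G)"
proof -
  interpret odd_group G
    using assms by (simp add: odd_group_def odd_group_axioms_def)
  have n0: "order G > 0" using assms(3) by (rule odd_pos)
  show ?thesis
  proof (cases "coprime a (int (order G))")
    case False
    then show ?thesis using jacobi_symbol_eq_0[OF n0] by (simp add: quadratic_symbol_def)
  next
    case True
    define b where "b = a mod int (order G)"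
    \<comment> \<open>Adding the odd group order makes the residue odd.\<close>
    define c where "c = (if odd b then b else b + int (order G))"
    define m where "m = nat c"
    have b0: "b \<ge> 0" using n0 by (simp add: b_def)
    then have m: "int m = c" by (simp add: m_def c_def)
    have "odd c" using assms(3) by (simp add: c_def)
    then have "odd m" using m by (metis even_of_nat_iff)
    have cong: "[a = int m] (mod int (order G))" unfolding m by (simp add: c_def b_def cong_def)
    then have "coprime (int m) (int (order G))" using cong_imp_coprime True by blast
    then have "quadratic_symbol (int m) G = jacobi_symbol (int m) (order G)"
      using quadratic_symbol_odd[OF \<open>odd m\<close>] by simp
    then show ?thesis
      using quadratic_symbol_cong[OF cong] jacobi_symbol_cong[OF cong] by simp
  qed
qed

end
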